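(* Let $d\geqslant 1$ be an integer and let $2<p<\infty$. There exist a compact set $S\subset\mathbb{R}^d$ and a Borel probability measure $\mu$ on $\mathbb{R}^d$ such that $\operatorname{supp}(\mu)\subset S$, $\hat{\mu}\in L_p(\mathbb{R}^d)$, and $\mathcal{H}_{\frac{2d}{p}}(S)=0$.
   Context: $\mathcal{H}_\alpha$ denotes the $\alpha$-dimensional Hausdorff measure on $\mathbb{R}^d$. The Fourier transform of a finite measure is $\hat\mu(\xi)=\int_{\mathbb{R}^d}e^{-2\pi i\langle x,\xi\rangle}\,d\mu(x)$. *)

theory Defs
  imports "HOL-Probability.Probability"
begin

(* Contribution of a covering set U to the s-dimensional Hausdorff measure: diam(U)^s, with the
   usual conventions for s = 0 (0^0 = 1 for nonempty U, whereas 0 powr 0 = 0) and for U empty. *)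
definition diam_powr :: "real \<Rightarrow> 'a::metric_space set \<Rightarrow> ennreal" where
  "diam_powr s U =
     (if U = {} then 0 else if s = 0 then 1 else ennreal (diameter U powr s))"

(* Covering sets are required to be bounded because the library's diameter is a real-valued
   supremum and hence meaningless on unbounded sets. *)
definition countable_covers :: "real \<Rightarrow> 'a::metric_space set \<Rightarrow> (nat \<Rightarrow> 'a set) set" where
  "countable_covers \<delta> A =
     {U. A \<subseteq> (\<Union>n. U n) \<and> (\<forall>n. bounded (U n) \<and> diameter (U n) \<le> \<delta>)}"

definition hausdorff_content :: "real \<Rightarrow> real \<Rightarrow> 'a::metric_space set \<Rightarrow> ennreal" where
  "hausdorff_content s \<delta> A = (INF U\<in>countable_covers \<delta> A. \<Sum>n. diam_powr s (U n))"

(* Hausdorff (outer) measure, without a normalising constant. *)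
definition hausdorff_measure :: "real \<Rightarrow> 'a::metric_space set \<Rightarrow> ennreal" where
  "hausdorff_measure s A = (SUP \<delta>\<in>{0<..}. hausdorff_content s \<delta> A)"

definition measure_support :: "'a::topological_space measure \<Rightarrow> 'a set" where
  "measure_support M = {x. \<forall>U. open U \<longrightarrow> x \<in> U \<longrightarrow> emeasure M U > 0}"

definition fourier_transform :: "'a::euclidean_space measure \<Rightarrow> 'a \<Rightarrow> complex" where
  "fourier_transform M \<xi> = (\<integral>x. exp (- 2 * of_real pi * \<i> * of_real (x \<bullet> \<xi>)) \<partial>M)"

definition in_Lp :: "real \<Rightarrow> ('a::euclidean_space \<Rightarrow> complex) \<Rightarrow> bool" where
  "in_Lp p f \<longleftrightarrow>
     f \<in> borel_measurable lebesgue \<and> integrable lebesgue (\<lambda>x. norm (f x) powr p)"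

end

theory Submission
  imports Defs
begin

text \<open>
  Put \<open>\<alpha> = 2d/p\<close>. Replacing a measure by \<open>N\<close> random bumps of radius \<open>r\<close> with \<open>N r\<^sup>\<alpha> = A\<close> changes its
  Fourier transform by a function with \<open>L\<^sub>p\<close> norm of order \<open>A^(-1/2)\<close>, independent of \<open>r\<close>; hence a single scale
  never reaches small covers. Averaging \<open>K\<close> such replacements at widely separated scales helps: the
  errors live on almost disjoint frequency ranges, so the \<open>p\<close>-th power of the norm of their average is
  of order \<open>K^(1-p) A^(-p/2)\<close>, while the bumps cost only \<open>K A\<close> in a cover. With \<open>A = K^(-s)\<close> and
  \<open>1 < s < 2 - 2/p\<close> both quantities tend to 0. Iterating, with each bump refined inside a neighbourhood of its
  parent, gives the measure as a limit; its Fourier transform is in \<open>L\<^sub>p\<close> by Fatou's lemma.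

  The random choice is derandomised: points are chosen one at a time, each keeping an exponential
  potential below its average.
\<close>

subsection \<open>The bump\<close>

text \<open>The exponent \<open>2d/p\<close> is borderline. With \<open>N\<close> sampled points the
  error has size about \<open>N^(-1/2)\<close> at a given frequency, and the transform of the new
  bumps damps it beyond frequency \<open>1/r\<close>, so the p-th power of its norm is about
  \<open>N^(-p/2) r^(-d)\<close>. Under \<open>N r^\<alpha> = A\<close> with
  \<open>\<alpha> p / 2 = d\<close> this is \<open>A^(-p/2)\<close>: no power of \<open>r\<close> is
  left to make it small, and decreasing \<open>A\<close>, as zero measure demands, makes it grow.
  What can be exploited is that on any fixed ball the error tends to 0 as \<open>N\<close> grows, so
  it escapes to high frequencies. A new scale can therefore be chosen almost disjoint in frequency
  from the finitely many earlier ones, and p-th powers of norms then add up instead of the norms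
  themselves. The resulting gain outweighs the loss from small \<open>A\<close> exactly because
  \<open>p > 2\<close>, which makes the interval for \<open>s\<close> nonempty. Until the limit is
  taken, a measure is represented only by its centres, its radii and its Fourier transform.\<close>

definition fchar :: "'a::real_inner \<Rightarrow> 'a \<Rightarrow> complex" where
  "fchar x \<xi> = cis (- (2 * pi * (x \<bullet> \<xi>)))"

lemma norm_fchar [simp]: "norm (fchar x \<xi>) = 1"
  by (simp add: fchar_def)

lemma fchar_zero [simp]: "fchar x 0 = 1" "fchar 0 \<xi> = 1"
  by (simp_all add: fchar_def)

lemma fchar_add: "fchar (x + y) \<xi> = fchar x \<xi> * fchar y \<xi>"
  by (simp add: fchar_def cis_mult inner_add_left algebra_simps)

lemma fchar_sum: "fchar (\<Sum>i\<in>I. f i) \<xi> = (\<Prod>i\<in>I. fchar (f i) \<xi>)"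
  by (induction I rule: infinite_finite_induct) (simp_all add: fchar_add)

lemma fchar_scaleR: "fchar (r *\<^sub>R x) \<xi> = fchar x (r *\<^sub>R \<xi>)"
  by (simp add: fchar_def)

lemma measurable_fchar [measurable (raw)]:
  fixes f g :: "'b \<Rightarrow> 'a::euclidean_space"
  assumes [measurable]: "f \<in> borel_measurable M" "g \<in> borel_measurable M"
  shows "(\<lambda>z. fchar (f z) (g z)) \<in> borel_measurable M"
  unfolding fchar_def cis_conv_exp by measurable

lemma fourier_transform_fchar: "fourier_transform M \<xi> = (\<integral>x. fchar x \<xi> \<partial>M)"
  unfolding fourier_transform_def fchar_def cis_conv_exp by (simp add: mult_ac)

lemma (in prob_space) integrable_fchar:
  fixes f :: "'a \<Rightarrow> 'b::euclidean_space"
  assumes [measurable]: "f \<in> borel_measurable M"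
  shows "integrable M (\<lambda>x. fchar (f x) \<xi>)"
  by (rule integrable_const_bound[where B = 1]) auto

lemma norm_fourier_transform_le_1:
  assumes "prob_space N"
  shows "norm (fourier_transform N \<xi>) \<le> 1"
proof -
  interpret N: prob_space N by fact
  have "norm (fourier_transform N \<xi>) \<le> (\<integral>x. norm (fchar x \<xi>) \<partial>N)"
    unfolding fourier_transform_fchar by (rule integral_norm_bound)
  then show ?thesis by (simp add: N.prob_space)
qed

lemma fourier_transform_0:
  assumes "prob_space N"
  shows "fourier_transform N 0 = 1"
  by (simp add: fourier_transform_fchar prob_space.prob_space[OF assms])

lemma continuous_on_fourier_transform:
  fixes N :: "'b::euclidean_space measure"
  assumes "prob_space N" and [measurable_cong]: "sets N = sets borel"
  shows "continuous_on UNIV (fourier_transform N)"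
proof (rule continuous_on_sequentiallyI)
  interpret N: prob_space N by fact
  fix u a assume "u \<longlonglongrightarrow> (a::'b)"
  show "(\<lambda>n. fourier_transform N (u n)) \<longlonglongrightarrow> fourier_transform N a"
    unfolding fourier_transform_fchar
  proof (rule integral_dominated_convergence[where w = "\<lambda>_. 1"])
    show "AE x in N. (\<lambda>n. fchar x (u n)) \<longlonglongrightarrow> fchar x a"
      using \<open>u \<longlonglongrightarrow> a\<close> unfolding fchar_def cis_conv_exp by (intro AE_I2 tendsto_intros)
  qed auto
qed

section \<open>A bump in the unit ball with p-integrable Fourier transform\<close>

definition unif :: "real \<Rightarrow> real measure" where
  "unif a = density lborel (\<lambda>x. ennreal (indicator {-a..a} x / (2 * a)))"

lemma sets_unif [simp, measurable_cong]: "sets (unif a) = sets borel"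
  by (simp add: unif_def)

lemma prob_space_unif:
  assumes "0 < a"
  shows "prob_space (unif a)"
proof
  have "emeasure (unif a) (space (unif a)) =
      (\<integral>\<^sup>+x. ennreal (1 / (2 * a)) * indicator {-a..a} x \<partial>lborel)"
    unfolding unif_def by (subst emeasure_density) (auto intro!: nn_integral_cong simp: indicator_def)
  also have "\<dots> = 1"
    using assms by (subst nn_integral_cmult_indicator) (auto simp flip: ennreal_mult)
  finally show "emeasure (unif a) (space (unif a)) = 1" .
qed

lemma AE_unif:
  assumes "0 < a"
  shows "AE s in unif a. \<bar>s\<bar> \<le> a"
  unfolding unif_def using assms by (subst AE_density) (auto simp: indicator_def)

text \<open>The transform is bounded by 1 trivially and by
  \<open>1 / (a * \<bar>\<tau>\<bar>)\<close> through an explicit antiderivative. Adding the squares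
  of the two bounds gives one majorant that is integrable over the whole line.\<close>

lemma norm_fourier_unif_le:
  assumes "0 < a"
  shows "(norm (\<integral>s. cis (- (2 * pi * (s * \<tau>))) \<partial>unif a))\<^sup>2 \<le> (1 + 1 / a\<^sup>2) / (1 + \<tau>\<^sup>2)"
proof -
  define N where "N = norm (\<integral>s. cis (- (2 * pi * (s * \<tau>))) \<partial>unif a)"
  interpret prob_space "unif a" using assms by (rule prob_space_unif)
  have "N \<le> (\<integral>s. norm (cis (- (2 * pi * (s * \<tau>)))) \<partial>unif a)"
    unfolding N_def by (rule integral_norm_bound)
  then have N1: "N \<le> 1" by (simp add: prob_space)
  have N0: "0 \<le> N" by (simp add: N_def)
  have N2: "N * (a * \<bar>\<tau>\<bar>) \<le> 1"
  proof (cases "\<tau> = 0")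
    case False
    define G where "G s = cis (- (2 * pi * (s * \<tau>))) / (- (2 * pi * \<tau>) * \<i>)" for s
    have G: "(G has_vector_derivative cis (- (2 * pi * (s * \<tau>)))) (at s within A)" for s A
    proof -
      define c where "c = - (2 * pi * \<tau>) * \<i>"
      have c: "c \<noteq> 0" using False by (simp add: c_def)
      have "((\<lambda>s. exp (c * of_real s) / c) has_vector_derivative exp (c * of_real s)) (at s within A)"
        by (rule has_vector_derivative_real_field) (use c in \<open>auto intro!: derivative_eq_intros\<close>)
      moreover have "exp (c * of_real s) = cis (- (2 * pi * (s * \<tau>)))" for s
        by (simp add: c_def cis_conv_exp mult_ac)
      ultimately show ?thesis by (simp add: G_def[abs_def] c_def)
    qed
    have "(\<integral>s. cis (- (2 * pi * (s * \<tau>))) \<partial>unif a) =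
       (\<integral>s. (indicator {-a..a} s / (2 * a)) *\<^sub>R cis (- (2 * pi * (s * \<tau>))) \<partial>lborel)"
      unfolding unif_def using assms by (subst integral_density) (auto simp: cis_conv_exp)
    also have "\<dots> = (\<integral>s. (1 / (2 * a)) *\<^sub>R (indicator {-a..a} s *\<^sub>R cis (- (2 * pi * (s * \<tau>)))) \<partial>lborel)"
      by simp
    also have "\<dots> = (1 / (2 * a)) *\<^sub>R (G a - G (-a))"
      using assms unfolding integral_scaleR_right
      by (subst integral_FTC_atLeastAtMost[of "-a" a G]) (auto intro!: G continuous_intros)
    finally have "N = norm (G a - G (-a)) / (2 * a)"
      using assms by (simp add: N_def)
    also have "norm (G a - G (-a)) \<le> norm (G a) + norm (G (-a))"
      by (rule norm_triangle_ineq4)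
    also have "\<dots> = 1 / (pi * \<bar>\<tau>\<bar>)"
      by (simp add: G_def norm_divide norm_mult abs_mult)
    also have "1 / (pi * \<bar>\<tau>\<bar>) \<le> 2 / \<bar>\<tau>\<bar>"
      using False pi_gt3 by (simp add: divide_simps)
    finally show ?thesis
      using assms False by (simp add: divide_simps mult_ac)
  qed simp
  have "N\<^sup>2 * (1 + \<tau>\<^sup>2) = N\<^sup>2 + (N * (a * \<bar>\<tau>\<bar>))\<^sup>2 / a\<^sup>2"
    using assms by (simp add: power_mult_distrib algebra_simps)
  also have "\<dots> \<le> 1 + 1 / a\<^sup>2"
    using N0 N1 N2 assms by (intro add_mono divide_right_mono power_le_one) auto
  finally show ?thesis
    unfolding N_def[symmetric] by (subst pos_le_divide_eq) (auto intro: add_pos_nonneg)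
qed

lemma nn_integral_inverse_1_plus_square:
  "(\<integral>\<^sup>+x. ennreal (1 / (1 + x\<^sup>2)) \<partial>lborel) < \<infinity>"
proof -
  have "integrable lborel (\<lambda>x::real. inverse (1 + x\<^sup>2))"
    using integrable_inverse_1_plus_square by (simp add: set_integrable_def)
  from integrableD(2)[OF this] show ?thesis
    by (simp add: field_simps top.not_eq_extremum)
qed

text \<open>The uniform distribution on a cube works: its transform factors over the coordinates,
  and each squared factor has an integrable majorant.\<close>

lemma exists_bump:
  fixes p :: real
  assumes "2 \<le> p"
  shows "\<exists>\<phi>::'a::euclidean_space measure. prob_space \<phi> \<and> sets \<phi> = sets borel \<and>
     (AE x in \<phi>. norm x \<le> 1) \<and>
     (\<integral>\<^sup>+\<xi>. ennreal (norm (fourier_transform \<phi> \<xi>) powr p) \<partial>lborel) < \<infinity>"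
proof -
  \<comment> \<open>Half the side of the cube; the norm is at most the sum of the absolute
    coordinates, so the cube lies in the unit ball.\<close>
  define a where "a = 1 / real DIM('a)"
  have a: "a > 0" by (simp add: a_def)
  define T where "T f = (\<Sum>b\<in>Basis. f b *\<^sub>R b)" for f :: "'a \<Rightarrow> real"
  define P where "P = PiM (Basis::'a set) (\<lambda>_. unif a)"
  define \<phi> where "\<phi> = distr P borel T"
  have [simp]: "product_prob_space (\<lambda>_::'a. unif a)"
    using prob_space_unif[OF a] by (simp add: product_prob_space_def product_sigma_finite_def
        product_prob_space_axioms_def prob_space_imp_sigma_finite)
  interpret product_prob_space "\<lambda>_::'a. unif a" by simp
  interpret PP: prob_space P unfolding P_def by (rule prob_space_PiM) (rule prob_space_unif[OF a])
  have T [measurable]: "T \<in> P \<rightarrow>\<^sub>M borel" unfolding T_def P_def by measurable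
  have "prob_space \<phi>" unfolding \<phi>_def by (rule PP.prob_space_distr) fact
  moreover have "AE x in \<phi>. norm x \<le> 1"
  proof -
    have "AE f in P. \<forall>b\<in>Basis. \<bar>f b\<bar> \<le> a"
      unfolding P_def by (intro AE_finite_allI AE_PiM_component prob_space_unif AE_unif a) auto
    then have "AE f in P. norm (T f) \<le> 1"
    proof eventually_elim
      case (elim f)
      have "norm (T f) \<le> (\<Sum>b\<in>(Basis::'a set). \<bar>f b\<bar>)"
        unfolding T_def by (rule order_trans[OF norm_sum]) simp
      also have "\<dots> \<le> (\<Sum>b\<in>(Basis::'a set). a)"
        using elim by (intro sum_mono) auto
      finally show ?case by (simp add: a_def)
    qed
    then show ?thesis
      unfolding \<phi>_def by (subst AE_distr_iff) auto
  qed
  moreover have "(\<integral>\<^sup>+\<xi>. ennreal (norm (fourier_transform \<phi> \<xi>) powr p) \<partial>lborel) < \<infinity>"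
  proof -
    define h where "h \<tau> = (\<integral>s. cis (- (2 * pi * (s * \<tau>))) \<partial>unif a)" for \<tau>
    have ft: "fourier_transform \<phi> \<xi> = (\<Prod>b\<in>Basis. h (\<xi> \<bullet> b))" for \<xi>
    proof -
      have "fourier_transform \<phi> \<xi> = (\<integral>f. fchar (T f) \<xi> \<partial>P)"
        unfolding fourier_transform_fchar \<phi>_def by (subst integral_distr) auto
      also have "\<dots> = (\<integral>f. (\<Prod>b\<in>Basis. cis (- (2 * pi * (f b * (\<xi> \<bullet> b))))) \<partial>P)"
        by (intro Bochner_Integration.integral_cong refl)
          (simp add: T_def fchar_sum, simp add: fchar_def inner_commute)
      also have "\<dots> = (\<Prod>b\<in>Basis. h (\<xi> \<bullet> b))"
        unfolding P_def h_def
      proof (rule product_integral_prod)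
        fix b :: 'a
        show "integrable (unif a) (\<lambda>x. cis (- (2 * pi * (x * (\<xi> \<bullet> b)))))"
          by (rule finite_measure.integrable_const_bound[OF prob_space.axioms(1)[OF prob_space_unif[OF a]], where B = 1])
            (auto simp: cis_conv_exp)
      qed simp
      finally show ?thesis .
    qed
    define C where "C = 1 + 1 / a\<^sup>2"
    have C: "C \<ge> 0" by (simp add: C_def)
    have "norm (fourier_transform \<phi> \<xi>) powr p \<le> (\<Prod>b\<in>Basis. C * (1 / (1 + (\<xi> \<bullet> b)\<^sup>2)))" for \<xi>
    proof -
      \<comment> \<open>The modulus is at most 1 and \<open>p\<close> at least 2, so square
        integrability is enough.\<close>
      have "norm (fourier_transform \<phi> \<xi>) powr p \<le> norm (fourier_transform \<phi> \<xi>) powr 2"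
        using norm_fourier_transform_le_1[OF \<open>prob_space \<phi>\<close>, of \<xi>] assms by (intro powr_mono') auto
      also have "\<dots> = (\<Prod>b\<in>Basis. (norm (h (\<xi> \<bullet> b)))\<^sup>2)"
        by (simp add: ft prod_norm[symmetric] prod_power_distrib powr_numeral prod_nonneg)
      also have "\<dots> \<le> (\<Prod>b\<in>Basis. C * (1 / (1 + (\<xi> \<bullet> b)\<^sup>2)))"
        using norm_fourier_unif_le[OF a] by (intro prod_mono) (auto simp: h_def C_def)
      finally show ?thesis .
    qed
    then have "(\<integral>\<^sup>+\<xi>. ennreal (norm (fourier_transform \<phi> \<xi>) powr p) \<partial>lborel) \<le>
       (\<integral>\<^sup>+(\<xi>::'a). (\<Prod>b\<in>Basis. ennreal (C * (1 / (1 + (\<xi> \<bullet> b)\<^sup>2)))) \<partial>lborel)"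
      using C by (intro nn_integral_mono) (auto simp: prod_ennreal intro!: ennreal_leI)
    also have "\<dots> = (\<Prod>b\<in>(Basis::'a set). (\<integral>\<^sup>+x. ennreal (C * (1 / (1 + x\<^sup>2))) \<partial>lborel))"
      by (rule nn_integral_lborel_prod) auto
    also have "(\<integral>\<^sup>+x. ennreal (C * (1 / (1 + x\<^sup>2))) \<partial>lborel) =
        ennreal C * (\<integral>\<^sup>+x. ennreal (1 / (1 + x\<^sup>2)) \<partial>lborel)"
      unfolding ennreal_mult'[OF C] by (rule nn_integral_cmult) measurable
    also have "(\<Prod>b\<in>(Basis::'a set). ennreal C * (\<integral>\<^sup>+x. ennreal (1 / (1 + x\<^sup>2)) \<partial>lborel)) < \<infinity>"
      using nn_integral_inverse_1_plus_square
      by (simp add: power_less_top_ennreal ennreal_mult_less_top)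
    finally show ?thesis .
  qed
  ultimately show ?thesis
    by (intro exI[of _ \<phi>]) (simp add: \<phi>_def)
qed

subsection \<open>Sampling\<close>

text \<open>The relation \<open>\<alpha> * p / 2 = DIM('a)\<close> is what later cancels the radius:
  \<open>N r^\<alpha> = A\<close> turns \<open>N^(-p/2)\<close> into
  \<open>A^(-p/2) r^d\<close>.\<close>

locale bump =
  fixes \<phi> :: "'a::euclidean_space measure" and p \<alpha> :: real
  assumes prob_bump: "prob_space \<phi>"
    and sets_bump [measurable_cong]: "sets \<phi> = sets borel"
    and AE_bump: "AE x in \<phi>. norm x \<le> 1"
    and p_gt_2: "2 < p" and \<alpha>_eq: "\<alpha> = 2 * real DIM('a) / p"
    and Lp_bump: "(\<integral>\<^sup>+\<xi>. ennreal (norm (fourier_transform \<phi> \<xi>) powr p) \<partial>lborel) < \<infinity>"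
begin

sublocale bump: prob_space \<phi> by (rule prob_bump)

abbreviation \<psi> :: "'a \<Rightarrow> complex" where "\<psi> \<equiv> fourier_transform \<phi>"

lemma norm_\<psi>_le: "norm (\<psi> \<xi>) \<le> 1"
  by (rule norm_fourier_transform_le_1) (rule prob_bump)

lemma \<psi>_0 [simp]: "\<psi> 0 = 1"
  by (rule fourier_transform_0) (rule prob_bump)

lemma continuous_on_\<psi>: "continuous_on UNIV \<psi>"
  by (rule continuous_on_fourier_transform) (rule prob_bump sets_bump)+

lemma measurable_\<psi> [measurable]: "\<psi> \<in> borel_measurable borel"
  using continuous_on_\<psi> by (rule borel_measurable_continuous_onI)

lemma tendsto_\<psi>:
  assumes "(r \<longlongrightarrow> 0) F"
  shows "((\<lambda>n. \<psi> (r n *\<^sub>R \<xi>)) \<longlongrightarrow> 1) F"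
proof -
  have "((\<lambda>n. \<psi> (r n *\<^sub>R \<xi>)) \<longlongrightarrow> \<psi> (0 *\<^sub>R \<xi>)) F"
    by (intro continuous_on_tendsto_compose[OF continuous_on_\<psi>] tendsto_intros assms) auto
  then show ?thesis by simp
qed

text \<open>The Fourier transform of the bump scaled by \<open>r\<close> and moved to \<open>y\<close>.\<close>

definition cell_ft :: "'a \<Rightarrow> real \<Rightarrow> 'a \<Rightarrow> complex" where
  "cell_ft y r \<xi> = fchar y \<xi> * \<psi> (r *\<^sub>R \<xi>)"

lemma norm_cell_ft_le: "norm (cell_ft y r \<xi>) \<le> 1"
  by (simp add: cell_ft_def norm_mult norm_\<psi>_le)

lemma measurable_cell_ft [measurable]: "cell_ft y r \<in> borel_measurable borel"
  unfolding cell_ft_def[abs_def] by measurable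

lemma cell_ft_eq_integral: "cell_ft y r \<xi> = (\<integral>u. fchar (y + r *\<^sub>R u) \<xi> \<partial>\<phi>)"
  by (simp add: cell_ft_def fourier_transform_fchar fchar_add fchar_scaleR)

text \<open>The centred summand of the sampling error: for \<open>x = y + r u\<close> with
  \<open>u\<close> distributed by \<open>\<phi>\<close> its mean is 0 at every frequency. The
  sampled point enters as a bare character; the blur by the new bump is applied afterwards.\<close>

definition dev :: "'a \<Rightarrow> real \<Rightarrow> 'a \<Rightarrow> 'a \<Rightarrow> complex" where
  "dev y r x \<xi> = fchar x \<xi> - cell_ft y r \<xi>"

lemma measurable_dev [measurable]: "dev y r x \<in> borel_measurable borel"
  unfolding dev_def[abs_def] by measurable

text \<open>The variable has mean 0 and values in \<open>[-2, 2]\<close>, so Hoeffding's lemma gives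
  the exponent \<open>s^2 * 4^2 / 8\<close>.\<close>

lemma hoeffding_dev:
  assumes "norm c \<le> 1" "0 < s"
  shows "(\<integral>\<^sup>+u. ennreal (exp (s * Re (c * dev y r (y + r *\<^sub>R u) \<xi>))) \<partial>\<phi>) \<le> ennreal (exp (2 * s\<^sup>2))"
proof -
  have *: "norm (c * dev y r x \<xi>) \<le> 2" for x
  proof -
    have "norm (dev y r x \<xi>) \<le> 1 + 1"
      unfolding dev_def by (rule norm_triangle_le_diff) (simp add: norm_cell_ft_le)
    with assms(1) have "norm c * norm (dev y r x \<xi>) \<le> 1 * 2"
      by (intro mult_mono) auto
    then show ?thesis by (simp add: norm_mult)
  qed
  interpret interval_bounded_random_variable \<phi> "\<lambda>u. Re (c * dev y r (y + r *\<^sub>R u) \<xi>)" "-2" 2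
  proof
    show "AE u in \<phi>. Re (c * dev y r (y + r *\<^sub>R u) \<xi>) \<in> {-2..2}"
    proof (rule AE_I2)
      fix u
      show "Re (c * dev y r (y + r *\<^sub>R u) \<xi>) \<in> {-2..2}"
        using order_trans[OF abs_Re_le_cmod *, of "y + r *\<^sub>R u"] by (auto simp: abs_le_iff simp del: times_complex.sel)
    qed
  qed (simp add: dev_def)
  have int: "integrable \<phi> (\<lambda>u. fchar (y + r *\<^sub>R u) \<xi>)"
    by (rule bump.integrable_fchar) simp
  have "(\<integral>u. Re (c * dev y r (y + r *\<^sub>R u) \<xi>) \<partial>\<phi>) = Re (c * (\<integral>u. dev y r (y + r *\<^sub>R u) \<xi> \<partial>\<phi>))"
    using int by (subst integral_Re) (simp_all add: dev_def del: times_complex.sel)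
  also have "(\<integral>u. dev y r (y + r *\<^sub>R u) \<xi> \<partial>\<phi>) = 0"
    using int by (simp add: dev_def bump.prob_space cell_ft_eq_integral)
  finally have "(\<integral>u. Re (c * dev y r (y + r *\<^sub>R u) \<xi>) \<partial>\<phi>) = 0" by simp
  from Hoeffdings_lemma_nn_integral_0[OF \<open>0 < s\<close> this] show ?thesis
    by (simp add: mult.commute)
qed

section \<open>Derandomised choice of points\<close>

text \<open>By Tonelli the mean of the potential over the cell is at most the right-hand side, so
  some point of the cell does no worse. The weights \<open>g c\<close> may depend on the direction
  because they will carry the exponentials of the points already chosen.\<close>

lemma exists_sample:
  assumes [measurable]: "\<And>c. c \<in> C \<Longrightarrow> g c \<in> borel_measurable lborel"
    and C: "finite C" "\<And>c. c \<in> C \<Longrightarrow> norm c \<le> 1" and s: "0 < s" and r: "0 \<le> r"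
  shows "\<exists>x. norm (x - y) \<le> r \<and>
    (\<integral>\<^sup>+\<xi>. (\<Sum>c\<in>C. g c \<xi> * ennreal (exp (s * Re (c * dev y r x \<xi>)))) \<partial>lborel) \<le>
    ennreal (exp (2 * s\<^sup>2)) * (\<integral>\<^sup>+\<xi>. (\<Sum>c\<in>C. g c \<xi>) \<partial>lborel)"
proof (rule ccontr)
  assume no: "\<not> ?thesis"
  define h where "h u = (\<integral>\<^sup>+\<xi>. (\<Sum>c\<in>C. g c \<xi> * ennreal (exp (s * Re (c * dev y r (y + r *\<^sub>R u) \<xi>)))) \<partial>lborel)" for u
  define R where "R = ennreal (exp (2 * s\<^sup>2)) * (\<integral>\<^sup>+\<xi>. (\<Sum>c\<in>C. g c \<xi>) \<partial>lborel)"
  interpret P: pair_sigma_finite lborel \<phi>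
    by (simp add: pair_sigma_finite_def prob_space_imp_sigma_finite prob_bump sigma_finite_lborel)
  have m [measurable]: "(\<lambda>(\<xi>, u). \<Sum>c\<in>C. g c \<xi> * ennreal (exp (s * Re (c * dev y r (y + r *\<^sub>R u) \<xi>))))
      \<in> borel_measurable (lborel \<Otimes>\<^sub>M \<phi>)"
    unfolding dev_def case_prod_beta by measurable
  have gt: "R < h u" if "norm u \<le> 1" for u
  proof -
    have "norm ((y + r *\<^sub>R u) - y) \<le> r"
      using that r by (simp add: mult_left_le)
    then have "\<not> h u \<le> R" using no unfolding h_def R_def by blast
    then show ?thesis by simp
  qed
  have [measurable]: "h \<in> borel_measurable \<phi>"
    unfolding h_def using m by measurable
  have "integral\<^sup>N \<phi> h = (\<integral>\<^sup>+\<xi>. (\<integral>\<^sup>+u. (\<Sum>c\<in>C. g c \<xi> * ennreal (exp (s * Re (c * dev y r (y + r *\<^sub>R u) \<xi>)))) \<partial>\<phi>) \<partial>lborel)"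
    unfolding h_def by (rule P.Fubini'[OF m])
  also have "\<dots> \<le> (\<integral>\<^sup>+\<xi>. (\<Sum>c\<in>C. g c \<xi> * ennreal (exp (2 * s\<^sup>2))) \<partial>lborel)"
  proof (rule nn_integral_mono)
    fix \<xi>
    have [measurable]: "(\<lambda>u. dev y r (y + r *\<^sub>R u) \<xi>) \<in> borel_measurable \<phi>"
      unfolding dev_def by measurable
    show "(\<integral>\<^sup>+u. (\<Sum>c\<in>C. g c \<xi> * ennreal (exp (s * Re (c * dev y r (y + r *\<^sub>R u) \<xi>)))) \<partial>\<phi>)
        \<le> (\<Sum>c\<in>C. g c \<xi> * ennreal (exp (2 * s\<^sup>2)))"
      using C s by (subst nn_integral_sum) (auto simp: nn_integral_cmult simp del: times_complex.sel intro!: sum_mono mult_left_mono hoeffding_dev)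
  qed
  also have "\<dots> = R"
    unfolding R_def sum_distrib_right[symmetric]
    by (subst mult.commute, rule nn_integral_cmult) measurable
  finally have le: "integral\<^sup>N \<phi> h \<le> R" .
  \<comment> \<open>Strict comparison of the two integrals requires the smaller one to be finite;
    lying strictly below \<open>h 0\<close> ensures that.\<close>
  have "R < \<infinity>" using gt[of 0] by (auto intro: less_le_trans)
  then have "integral\<^sup>N \<phi> (\<lambda>_. R) < integral\<^sup>N \<phi> h"
  proof (intro nn_integral_less)
    show "AE u in \<phi>. R \<le> h u"
      using AE_bump by eventually_elim (use gt in \<open>auto intro: less_imp_le\<close>)
    show "\<not> (AE u in \<phi>. h u \<le> R)"
    proof
      assume "AE u in \<phi>. h u \<le> R"
      with AE_bump have "AE u in \<phi>. False"
        by eventually_elim (use gt in \<open>auto simp: not_less[symmetric]\<close>)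
      then show False by simp
    qed
  qed (simp_all add: bump.emeasure_space_1)
  with le show False by (simp add: bump.emeasure_space_1)
qed

text \<open>Four directions suffice to control the modulus of a complex sum by real exponential moments.\<close>

definition dirs :: "complex set" where "dirs = {1, -1, \<i>, -\<i>}"

lemma dirs: "finite dirs" "card dirs = 4" "c \<in> dirs \<Longrightarrow> norm c \<le> 1"
  unfolding dirs_def by (simp, simp add: complex_eq_iff, auto)

text \<open>Each chosen point multiplies the bound by \<open>exp (2 * s^2)\<close>, and its own
  exponential joins the weight for the next choice. The factor 4 is the number of directions, the
  value of the potential before any choice.\<close>

lemma exists_samples_potential:
  fixes n :: nat
  assumes [measurable]: "w \<in> borel_measurable lborel" and s: "0 < s" and r: "\<And>j. 0 \<le> r j"
  shows "\<exists>x. (\<forall>j<n. norm (x j - y j) \<le> r j) \<and>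
    (\<integral>\<^sup>+\<xi>. (\<Sum>c\<in>dirs. w \<xi> * ennreal (exp (s * Re (c * (\<Sum>j<n. dev (y j) (r j) (x j) \<xi>))))) \<partial>lborel) \<le>
    ennreal (exp (2 * s\<^sup>2 * n)) * (4 * (\<integral>\<^sup>+\<xi>. w \<xi> \<partial>lborel))"
proof (induction n)
  case 0
  show ?case by (simp add: dirs nn_integral_cmult)
next
  case (Suc n)
  then obtain x where x: "\<forall>j<n. norm (x j - y j) \<le> r j"
    "(\<integral>\<^sup>+\<xi>. (\<Sum>c\<in>dirs. w \<xi> * ennreal (exp (s * Re (c * (\<Sum>j<n. dev (y j) (r j) (x j) \<xi>))))) \<partial>lborel) \<le>
    ennreal (exp (2 * s\<^sup>2 * n)) * (4 * (\<integral>\<^sup>+\<xi>. w \<xi> \<partial>lborel))" (is "?A \<le> ?B") by blast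
  obtain x' where x': "norm (x' - y n) \<le> r n"
    "(\<integral>\<^sup>+\<xi>. (\<Sum>c\<in>dirs. w \<xi> * ennreal (exp (s * Re (c * (\<Sum>j<n. dev (y j) (r j) (x j) \<xi>)))) *
       ennreal (exp (s * Re (c * dev (y n) (r n) x' \<xi>)))) \<partial>lborel) \<le> ennreal (exp (2 * s\<^sup>2)) * ?A"
    using exists_sample[of dirs "\<lambda>c \<xi>. w \<xi> * ennreal (exp (s * Re (c * (\<Sum>j<n. dev (y j) (r j) (x j) \<xi>))))" s "r n" "y n"]
      s r dirs by (auto simp del: times_complex.sel)
  define X where "X = x(n := x')"
  have "(\<integral>\<^sup>+\<xi>. (\<Sum>c\<in>dirs. w \<xi> * ennreal (exp (s * Re (c * (\<Sum>j<Suc n. dev (y j) (r j) (X j) \<xi>))))) \<partial>lborel) =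
    (\<integral>\<^sup>+\<xi>. (\<Sum>c\<in>dirs. w \<xi> * ennreal (exp (s * Re (c * (\<Sum>j<n. dev (y j) (r j) (x j) \<xi>)))) *
       ennreal (exp (s * Re (c * dev (y n) (r n) x' \<xi>)))) \<partial>lborel)"
    by (intro nn_integral_cong sum.cong refl)
      (simp add: X_def distrib_left exp_add ennreal_mult mult.assoc del: times_complex.sel)
  also have "\<dots> \<le> ennreal (exp (2 * s\<^sup>2)) * ?B"
    using x'(2) x(2) by (meson mult_left_mono order_trans zero_le)
  also have "\<dots> = ennreal (exp (2 * s\<^sup>2 * Suc n)) * (4 * (\<integral>\<^sup>+\<xi>. w \<xi> \<partial>lborel))"
    by (simp add: algebra_simps exp_add ennreal_mult)
  finally show ?case
    using x(1) x'(1) by (intro exI[of _ X]) (auto simp: X_def less_Suc_eq)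
qed

text \<open>\<open>(2 * p) powr p\<close> is the price of dominating a power by exponentials; 4
  counts the directions, and \<open>exp 2\<close> is the growth of the potential over all
  \<open>N\<close> choices when \<open>s^2 * N = 1\<close>.\<close>

definition moment_const :: real where "moment_const = (2 * p) powr p * (4 * exp 2)"

text \<open>Writing \<open>t\<close> for \<open>s * norm z\<close>, the inequality
  \<open>t / (2 * p) \<le> exp (t / (2 * p))\<close> gives
  \<open>t powr p \<le> (2 * p) powr p * exp (t / 2)\<close>. Halving the exponent matters: one of
  the four directions always captures at least half of the modulus.\<close>

lemma powr_le_sum_exp:
  assumes "0 < s"
  shows "(s * norm z) powr p \<le> (2 * p) powr p * (\<Sum>c\<in>dirs. exp (s * Re (c * z)))"
proof -
  define t where "t = s * norm z"
  have t: "t \<ge> 0" using assms by (simp add: t_def)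
  have p: "p > 0" using p_gt_2 by simp
  have "t powr p \<le> (2 * p * exp (t / (2 * p))) powr p"
  proof (rule powr_mono2)
    have "t / (2 * p) \<le> exp (t / (2 * p))"
      by (rule order_trans[OF _ exp_ge_add_one_self]) simp
    then show "t \<le> 2 * p * exp (t / (2 * p))" using p by (simp add: field_simps)
  qed (use t p in auto)
  also have "\<dots> = (2 * p) powr p * exp (t / 2)"
    using p by (simp add: powr_mult exp_powr_real)
  also have "exp (t / 2) \<le> (\<Sum>c\<in>dirs. exp (s * Re (c * z)))"
  proof -
    have "norm z / 2 \<le> \<bar>Re z\<bar> \<or> norm z / 2 \<le> \<bar>Im z\<bar>"
      using cmod_le[of z] by linarith
    then have "\<exists>c\<in>dirs. norm z / 2 \<le> Re (c * z)"
      by (auto simp: dirs_def abs_if split: if_splits)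
    then obtain c where c: "c \<in> dirs" "norm z / 2 \<le> Re (c * z)" by blast
    then have "t / 2 \<le> s * Re (c * z)"
      using assms by (simp add: t_def mult_left_mono del: times_complex.sel)
    then have "exp (t / 2) \<le> exp (s * Re (c * z))" by (simp only: exp_le_cancel_iff)
    also have "\<dots> \<le> (\<Sum>c\<in>dirs. exp (s * Re (c * z)))"
      using c(1) dirs(1) by (intro member_le_sum) auto
    finally show ?thesis .
  qed
  finally show ?thesis by (simp add: t_def mult_left_mono)
qed

text \<open>Square-root cancellation in the p-th mean, for deterministic points. The weight is
  arbitrary, so that a single choice of points can serve two estimates at once.\<close>

lemma exists_samples:
  fixes N :: nat
  assumes [measurable]: "w \<in> borel_measurable lborel" and N: "0 < N" and r: "\<And>j. 0 \<le> r j"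
  shows "\<exists>x. (\<forall>j<N. norm (x j - y j) \<le> r j) \<and>
    (\<integral>\<^sup>+\<xi>. w \<xi> * ennreal (norm ((\<Sum>j<N. dev (y j) (r j) (x j) \<xi>) / of_nat N) powr p) \<partial>lborel) \<le>
    ennreal (moment_const * real N powr (- p / 2)) * (\<integral>\<^sup>+\<xi>. w \<xi> \<partial>lborel)"
proof -
  \<comment> \<open>The largest order of \<open>s\<close> for which the accumulated factor
    \<open>exp (2 * s^2 * N)\<close> stays bounded.\<close>
  define s where "s = real N powr (-1/2)"
  have s: "s > 0" "s\<^sup>2 * N = 1"
    using N by (simp_all add: s_def powr_power powr_minus field_simps)
  obtain x where x: "(\<forall>j<N. norm (x j - y j) \<le> r j) \<and>
    (\<integral>\<^sup>+\<xi>. (\<Sum>c\<in>dirs. w \<xi> * ennreal (exp (s * Re (c * (\<Sum>j<N. dev (y j) (r j) (x j) \<xi>))))) \<partial>lborel) \<le>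
    ennreal (exp (2 * s\<^sup>2 * N)) * (4 * (\<integral>\<^sup>+\<xi>. w \<xi> \<partial>lborel))"
    using exists_samples_potential[where r = r and n = N and y = y, OF assms(1) s(1) r] ..
  define K where "K = (2 * p) powr p * real N powr (- p / 2)"
  have K: "K \<ge> 0" by (simp add: K_def)
  have bd: "norm (z / of_nat N) powr p \<le> K * (\<Sum>c\<in>dirs. exp (s * Re (c * z)))" for z :: complex
  proof -
    have "norm (z / of_nat N) = s * (s * norm z)"
      using s N by (simp add: norm_divide field_simps power2_eq_square) 
    then have "norm (z / of_nat N) powr p = s powr p * (s * norm z) powr p"
      using s by (simp add: powr_mult)
    also have "\<dots> \<le> s powr p * ((2 * p) powr p * (\<Sum>c\<in>dirs. exp (s * Re (c * z))))"
      using s by (intro mult_left_mono powr_le_sum_exp) auto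
    also have "s powr p = real N powr (- p / 2)"
      by (simp add: s_def powr_powr)
    finally show ?thesis by (simp add: K_def mult_ac)
  qed
  have "(\<integral>\<^sup>+\<xi>. w \<xi> * ennreal (norm ((\<Sum>j<N. dev (y j) (r j) (x j) \<xi>) / of_nat N) powr p) \<partial>lborel) \<le>
    (\<integral>\<^sup>+\<xi>. ennreal K * (\<Sum>c\<in>dirs. w \<xi> * ennreal (exp (s * Re (c * (\<Sum>j<N. dev (y j) (r j) (x j) \<xi>))))) \<partial>lborel)"
  proof (intro nn_integral_mono)
    fix \<xi>
    let ?z = "\<Sum>j<N. dev (y j) (r j) (x j) \<xi>"
    have "w \<xi> * ennreal (norm (?z / of_nat N) powr p) \<le> w \<xi> * ennreal (K * (\<Sum>c\<in>dirs. exp (s * Re (c * ?z))))"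
      by (intro mult_left_mono ennreal_leI bd) auto
    also have "\<dots> = ennreal K * (\<Sum>c\<in>dirs. w \<xi> * ennreal (exp (s * Re (c * ?z))))"
      using K by (simp add: ennreal_mult sum_nonneg mult_ac sum_distrib_left[symmetric] flip: sum_ennreal del: times_complex.sel)
    finally show "w \<xi> * ennreal (norm (?z / of_nat N) powr p) \<le> ennreal K * (\<Sum>c\<in>dirs. w \<xi> * ennreal (exp (s * Re (c * ?z))))" .
  qed
  also have "\<dots> = ennreal K * (\<integral>\<^sup>+\<xi>. (\<Sum>c\<in>dirs. w \<xi> * ennreal (exp (s * Re (c * (\<Sum>j<N. dev (y j) (r j) (x j) \<xi>))))) \<partial>lborel)"
    by (rule nn_integral_cmult) measurable
  also have "\<dots> \<le> ennreal K * (ennreal (exp (2 * s\<^sup>2 * N)) * (4 * (\<integral>\<^sup>+\<xi>. w \<xi> \<partial>lborel)))"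
    by (intro mult_left_mono conjunct2[OF x]) auto
  also have "2 * s\<^sup>2 * N = 2" using s by simp
  also have "ennreal K * (ennreal (exp 2) * (4 * (\<integral>\<^sup>+\<xi>. w \<xi> \<partial>lborel))) =
      ennreal (moment_const * real N powr (- p / 2)) * (\<integral>\<^sup>+\<xi>. w \<xi> \<partial>lborel)"
    using K by (simp add: K_def moment_const_def ennreal_mult mult_ac)
  finally show ?thesis using conjunct1[OF x] by blast
qed

end

subsection \<open>Integrals of p-th powers\<close>

text \<open>The p-th power of the norm, with no root taken, because this quantity is additive over
  disjoint sets.\<close>

definition Lp_on :: "real \<Rightarrow> 'a::euclidean_space set \<Rightarrow> ('a \<Rightarrow> complex) \<Rightarrow> ennreal" where
  "Lp_on p B f = (\<integral>\<^sup>+\<xi>. ennreal (norm (f \<xi>) powr p) * indicator B \<xi> \<partial>lborel)"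

lemma Lp_on_mono:
  assumes "0 \<le> p" "\<And>\<xi>. norm (f \<xi>) \<le> norm (g \<xi>)" "A \<subseteq> B"
  shows "Lp_on p A f \<le> Lp_on p B g"
  unfolding Lp_on_def using assms
  by (intro nn_integral_mono mult_mono ennreal_leI powr_mono2) (auto simp: indicator_def)

lemma Lp_on_split:
  assumes [measurable]: "f \<in> borel_measurable borel" "B \<in> sets borel"
  shows "Lp_on p UNIV f = Lp_on p B f + Lp_on p (- B) f"
  unfolding Lp_on_def
  by (subst nn_integral_add[symmetric]) (auto intro!: nn_integral_cong simp: indicator_def)

lemma Lp_on_cmult:
  assumes [measurable]: "f \<in> borel_measurable borel" "B \<in> sets borel"
  shows "Lp_on p B (\<lambda>\<xi>. c * f \<xi>) = ennreal (norm c powr p) * Lp_on p B f"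
  unfolding Lp_on_def
  by (subst nn_integral_cmult[symmetric])
    (auto intro!: nn_integral_cong simp: norm_mult powr_mult ennreal_mult mult_ac)

text \<open>Convexity of the power is applied at positive arguments; when one argument vanishes,
  \<open>s powr p \<le> s\<close> for \<open>s\<close> below 1 suffices.\<close>

lemma convex_powr_le:
  fixes x y t p :: real
  assumes t: "0 < t" "t < 1" and p: "1 \<le> p" and xy: "0 \<le> x" "0 \<le> y"
  shows "((1 - t) * x + t * y) powr p \<le> (1 - t) * x powr p + t * y powr p"
proof -
  have small: "(s * z) powr p \<le> s * z powr p" if "0 < s" "s < 1" "0 \<le> z" for s z
  proof -
    have "s powr p \<le> s powr 1" using that p by (intro powr_mono') auto
    then show ?thesis using that by (simp add: powr_mult mult_right_mono)
  qed
  consider "x = 0" | "y = 0" | "x > 0" "y > 0" using xy by force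
  then show ?thesis
  proof cases
    case 3
    then show ?thesis
      using convex_onD[OF powr_convex[OF p], of t x y] t by simp
  qed (use small[of t y] small[of "1 - t" x] t xy p in auto)
qed

text \<open>Convexity applied to \<open>a / (1 - t)\<close> and \<open>b / t\<close>. The asymmetry
  is the point: as \<open>t\<close> tends to 0 the coefficient of \<open>a\<close> tends to 1, so a
  much smaller \<open>b\<close> is absorbed at almost no cost to the main term.\<close>

lemma norm_add_powr_le:
  fixes a b :: complex
  assumes t: "0 < t" "t < 1" and p: "1 \<le> p"
  shows "norm (a + b) powr p \<le> (1 - t) powr (1 - p) * norm a powr p + t powr (1 - p) * norm b powr p"
proof -
  have eq: "s * (z / s) powr p = s powr (1 - p) * z powr p" if "0 < s" "0 \<le> z" for s z :: real
    using that by (simp add: powr_divide powr_diff)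
  have "norm (a + b) powr p \<le> ((1 - t) * (norm a / (1 - t)) + t * (norm b / t)) powr p"
    using t p by (intro powr_mono2) (auto simp: norm_triangle_ineq)
  also have "\<dots> \<le> (1 - t) * (norm a / (1 - t)) powr p + t * (norm b / t) powr p"
    using t p by (intro convex_powr_le) auto
  finally show ?thesis using eq[of t "norm b"] eq[of "1 - t" "norm a"] t by simp
qed

lemma Lp_on_add_le:
  assumes [measurable]: "f \<in> borel_measurable borel" "g \<in> borel_measurable borel" "B \<in> sets borel"
    and t: "0 < t" "t < 1" and p: "1 \<le> p"
  shows "Lp_on p B (\<lambda>\<xi>. f \<xi> + g \<xi>) \<le>
    ennreal ((1 - t) powr (1 - p)) * Lp_on p B f + ennreal (t powr (1 - p)) * Lp_on p B g"
proof -
  have "Lp_on p B (\<lambda>\<xi>. f \<xi> + g \<xi>) \<le> (\<integral>\<^sup>+\<xi>. ennreal ((1 - t) powr (1 - p)) * (ennreal (norm (f \<xi>) powr p) * indicator B \<xi>) +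
     ennreal (t powr (1 - p)) * (ennreal (norm (g \<xi>) powr p) * indicator B \<xi>) \<partial>lborel)"
    unfolding Lp_on_def
  proof (rule nn_integral_mono)
    fix \<xi>
    show "ennreal (norm (f \<xi> + g \<xi>) powr p) * indicator B \<xi> \<le>
      ennreal ((1 - t) powr (1 - p)) * (ennreal (norm (f \<xi>) powr p) * indicator B \<xi>) +
      ennreal (t powr (1 - p)) * (ennreal (norm (g \<xi>) powr p) * indicator B \<xi>)"
      using norm_add_powr_le[OF t p, of "f \<xi>" "g \<xi>"]
      by (auto simp: indicator_def simp flip: ennreal_mult ennreal_plus intro!: ennreal_leI)
  qed
  also have "\<dots> = ennreal ((1 - t) powr (1 - p)) * Lp_on p B f + ennreal (t powr (1 - p)) * Lp_on p B g"
    unfolding Lp_on_def by (subst nn_integral_add) (auto simp: nn_integral_cmult)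
  finally show ?thesis .
qed

lemma Lp_on_outside_ball_tendsto_0:
  assumes [measurable]: "f \<in> borel_measurable borel" and fin: "Lp_on p UNIV f < \<infinity>"
  shows "(\<lambda>n. Lp_on p (- ball 0 (real n)) f) \<longlonglongrightarrow> 0"
proof -
  have "(\<lambda>n. Lp_on p (- ball 0 (real n)) f) \<longlonglongrightarrow> (\<integral>\<^sup>+x. 0 \<partial>(lborel :: 'a measure))"
    unfolding Lp_on_def
  proof (rule nn_integral_dominated_convergence[where w = "\<lambda>x. ennreal (norm (f x) powr p)"])
    show "AE x in lborel. (\<lambda>n. ennreal (norm (f x) powr p) * indicator (- ball 0 (real n)) x) \<longlonglongrightarrow> 0"
    proof (rule AE_I2)
      fix x :: 'a
      have "\<forall>\<^sub>F n in sequentially. real n > norm x"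
        using filterlim_real_sequentially by (rule filterlim_at_top_dense[THEN iffD1, rule_format])
      then have "\<forall>\<^sub>F n in sequentially. ennreal (norm (f x) powr p) * indicator (- ball 0 (real n)) x = 0"
        by eventually_elim simp
      then show "(\<lambda>n. ennreal (norm (f x) powr p) * indicator (- ball 0 (real n)) x) \<longlonglongrightarrow> 0"
        by (rule tendsto_eventually)
    qed
  qed (use fin in \<open>auto simp: Lp_on_def indicator_def\<close>)
  then show ?thesis by simp
qed

text \<open>A perturbation that is small on the ball carrying most of \<open>G\<close> adds to it like a function of
  disjoint support.\<close>

lemma Lp_on_add_almost_disjoint:
  fixes G :: "'a::euclidean_space \<Rightarrow> complex"
  assumes [measurable]: "G \<in> borel_measurable borel" and fin: "Lp_on p UNIV G < \<infinity>"
    and c: "0 \<le> c" and p: "1 \<le> p"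
  shows "\<exists>(n::nat) \<eta>. 0 < \<eta> \<and> (\<forall>e\<in>borel_measurable borel.
     Lp_on p UNIV e \<le> ennreal c \<longrightarrow> Lp_on p (ball 0 (real n)) e \<le> ennreal \<eta> \<longrightarrow>
     Lp_on p UNIV (\<lambda>\<xi>. G \<xi> + e \<xi>) \<le> Lp_on p UNIV G + ennreal (c + 1))"
proof -
  define I where "I = enn2real (Lp_on p UNIV G)"
  have I: "Lp_on p UNIV G = ennreal I" "0 \<le> I" using fin by (auto simp: I_def)
  \<comment> \<open>The admissible excess 1 is split in half: \<open>t\<close> is chosen so that the
    coefficient of the main terms costs at most \<open>1/2\<close>.\<close>
  have "((\<lambda>t. (1 - t) powr (1 - p) * (I + c)) \<longlongrightarrow> (1 - 0) powr (1 - p) * (I + c)) (at_right 0)"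
    by (intro tendsto_intros) auto
  then have "\<forall>\<^sub>F t in at_right 0. (1 - t) powr (1 - p) * (I + c) < I + c + 1 / 2"
    by (rule order_tendstoD) simp
  moreover have "\<forall>\<^sub>F t in at_right (0::real). 0 < t \<and> t < 1"
    by (auto simp: eventually_at_right_field intro!: exI[of _ 1])
  ultimately have "\<forall>\<^sub>F t in at_right (0::real). (1 - t) powr (1 - p) * (I + c) < I + c + 1 / 2 \<and> 0 < t \<and> t < 1"
    by eventually_elim simp
  then obtain t where t: "(1 - t) powr (1 - p) * (I + c) < I + c + 1 / 2" "0 < t" "t < 1"
    using eventually_happens'[OF trivial_limit_at_right_real] by blast
  define f where "f = (1 - t) powr (1 - p)"
  define K where "K = t powr (1 - p)"
  have K: "K > 0" using t by (simp add: K_def)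
  have f: "f \<ge> 0" by (simp add: f_def)
  \<comment> \<open>Two minor terms occur, each at most \<open>K * \<eta>\<close>; together they use
    up the other half.\<close>
  define \<eta> where "\<eta> = 1 / (4 * K)"
  have \<eta>: "\<eta> > 0" using K by (simp add: \<eta>_def)
  have "\<forall>\<^sub>F n in sequentially. Lp_on p (- ball 0 (real n)) G < ennreal \<eta>"
    using Lp_on_outside_ball_tendsto_0[OF assms(1) fin] \<eta> by (intro order_tendstoD) auto
  then obtain n where n: "Lp_on p (- ball 0 (real n)) G < ennreal \<eta>"
    by (auto simp: eventually_sequentially)
  define B where "B = ball (0::'a) (real n)"
  have [measurable]: "B \<in> sets borel" by (simp add: B_def)
  have "Lp_on p UNIV (\<lambda>\<xi>. G \<xi> + e \<xi>) \<le> Lp_on p UNIV G + ennreal (c + 1)"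
    if [measurable]: "e \<in> borel_measurable borel" and e: "Lp_on p UNIV e \<le> ennreal c"
      and eB: "Lp_on p B e \<le> ennreal \<eta>" for e
  proof -
    \<comment> \<open>On \<open>B\<close> the main term is \<open>G\<close>, off \<open>B\<close> it
      is \<open>e\<close>; the summands are swapped there so that the cheap coefficient always meets
      the main term.\<close>
    have "Lp_on p UNIV (\<lambda>\<xi>. G \<xi> + e \<xi>) = Lp_on p B (\<lambda>\<xi>. G \<xi> + e \<xi>) + Lp_on p (- B) (\<lambda>\<xi>. e \<xi> + G \<xi>)"
      by (subst Lp_on_split[of _ B]) (auto simp: add.commute)
    also have "\<dots> \<le> (ennreal f * Lp_on p B G + ennreal K * Lp_on p B e) +
       (ennreal f * Lp_on p (- B) e + ennreal K * Lp_on p (- B) G)"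
      unfolding f_def K_def using t p by (intro add_mono Lp_on_add_le) auto
    also have "\<dots> \<le> (ennreal f * ennreal I + ennreal K * ennreal \<eta>) + (ennreal f * ennreal c + ennreal K * ennreal \<eta>)"
    proof (intro add_mono mult_left_mono eB)
      show "Lp_on p B G \<le> ennreal I"
        unfolding I(1)[symmetric] using p by (intro Lp_on_mono) auto
      show "Lp_on p (- B) e \<le> ennreal c"
        using p by (intro order_trans[OF Lp_on_mono e]) auto
      show "Lp_on p (- B) G \<le> ennreal \<eta>" using n by (simp add: B_def)
    qed auto
    also have "\<dots> = ennreal (f * (I + c) + 2 * (K * \<eta>))"
      using f K I c \<eta> by (simp add: algebra_simps flip: ennreal_mult ennreal_plus)
    also have "\<dots> \<le> ennreal (I + (c + 1))"
      using t(1) K by (intro ennreal_leI) (simp add: f_def[symmetric] \<eta>_def)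
    also have "\<dots> = Lp_on p UNIV G + ennreal (c + 1)"
      using I c by (simp add: ennreal_plus)
    finally show ?thesis .
  qed
  then show ?thesis using \<eta> unfolding B_def by blast
qed

lemma nn_integral_lborel_scaleR:
  fixes g :: "'a::euclidean_space \<Rightarrow> ennreal"
  assumes [measurable]: "g \<in> borel_measurable borel" and r: "0 < r"
  shows "ennreal (r ^ DIM('a)) * (\<integral>\<^sup>+\<xi>. g (r *\<^sub>R \<xi>) \<partial>lborel) = (\<integral>\<^sup>+\<xi>. g \<xi> \<partial>lborel)"
proof -
  have "(\<integral>\<^sup>+\<xi>. g \<xi> \<partial>lborel) = (\<integral>\<^sup>+\<xi>. g \<xi> \<partial>(density (distr lborel borel (\<lambda>x. 0 + r *\<^sub>R x)) (\<lambda>_. ennreal (\<bar>r\<bar> ^ DIM('a)))))"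
    by (subst lborel_affine[of r 0]) (use r in auto)
  also have "\<dots> = ennreal (r ^ DIM('a)) * (\<integral>\<^sup>+\<xi>. g (r *\<^sub>R \<xi>) \<partial>lborel)"
    using r by (subst nn_integral_density) (auto simp: nn_integral_cmult nn_integral_distr)
  finally show ?thesis by simp
qed

subsection \<open>Refinement\<close>

context bump
begin

text \<open>The transform of the equal-weight average of \<open>M\<close> bumps with centres
  \<open>y\<close> and individual radii \<open>\<delta>\<close>; the radii differ because one
  refinement mixes several scales.\<close>

definition state_ft :: "nat \<Rightarrow> (nat \<Rightarrow> 'a) \<Rightarrow> (nat \<Rightarrow> real) \<Rightarrow> 'a \<Rightarrow> complex" where
  "state_ft M y \<delta> \<xi> = (\<Sum>i<M. cell_ft (y i) (\<delta> i) \<xi>) / of_nat M"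

lemma measurable_state_ft [measurable]: "state_ft M y \<delta> \<in> borel_measurable borel"
  unfolding state_ft_def[abs_def] by measurable

text \<open>A replacement at one scale: every one of the \<open>M\<close> parent cells gets
  \<open>L\<close> children, all of the same radius.\<close>

definition piece_ft :: "nat \<Rightarrow> nat \<Rightarrow> (nat \<Rightarrow> nat \<Rightarrow> 'a) \<Rightarrow> real \<Rightarrow> 'a \<Rightarrow> complex" where
  "piece_ft M L x r \<xi> = (\<Sum>i<M. \<Sum>l<L. cell_ft (x i l) r \<xi>) / of_nat (M * L)"

lemma measurable_piece_ft [measurable]: "piece_ft M L x r \<in> borel_measurable borel"
  unfolding piece_ft_def[abs_def] by measurable

definition bump_norm :: real where
  "bump_norm = enn2real (\<integral>\<^sup>+\<xi>. ennreal (norm (\<psi> \<xi>) powr p) \<partial>lborel)"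

lemma bump_norm: "(\<integral>\<^sup>+\<xi>. ennreal (norm (\<psi> \<xi>) powr p) \<partial>lborel) = ennreal bump_norm" "0 \<le> bump_norm"
  using Lp_bump by (auto simp: bump_norm_def)

lemma moment_const_pos: "0 < moment_const"
  using p_gt_2 by (simp add: moment_const_def)

text \<open>The factor \<open>2 powr (p - 1)\<close> comes from splitting the error into sampling
  and blur; \<open>moment_const * (bump_norm + 1)\<close> bounds the former, the last 1 the
  latter.\<close>

definition err_const :: real where
  "err_const = 2 powr (p - 1) * (moment_const * (bump_norm + 1) + 1)"

lemma err_const_pos: "0 < err_const"
  using moment_const_pos bump_norm by (simp add: err_const_def add_nonneg_pos)

lemma \<alpha>_pos: "0 < \<alpha>" using p_gt_2 by (simp add: \<alpha>_eq)

lemma Lp_on_add_half: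
  assumes [measurable]: "f \<in> borel_measurable borel" "g \<in> borel_measurable borel" "B \<in> sets borel"
  shows "Lp_on p B (\<lambda>\<xi>. f \<xi> + g \<xi>) \<le> ennreal (2 powr (p - 1)) * (Lp_on p B f + Lp_on p B g)"
proof -
  have "(1/2::real) powr (1 - p) = 2 powr (p - 1)"
    by (simp add: powr_divide powr_diff powr_minus field_simps)
  then show ?thesis
    using Lp_on_add_le[of f g B "1/2" p] p_gt_2 by (simp add: distrib_left)
qed

text \<open>Dominated convergence with majorant \<open>norm (2 * F \<xi>) powr p\<close>; the
  integrand vanishes in the limit because \<open>\<psi>\<close> is continuous with value 1 at the
  origin.\<close>

lemma Lp_on_blur_tendsto_0:
  assumes [measurable]: "F \<in> borel_measurable borel" and fin: "Lp_on p UNIV F < \<infinity>"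
    and r: "r \<longlonglongrightarrow> 0"
  shows "(\<lambda>n. Lp_on p UNIV (\<lambda>\<xi>. (\<psi> (r n *\<^sub>R \<xi>) - 1) * F \<xi>)) \<longlonglongrightarrow> 0"
proof -
  have "(\<lambda>n. Lp_on p UNIV (\<lambda>\<xi>. (\<psi> (r n *\<^sub>R \<xi>) - 1) * F \<xi>)) \<longlonglongrightarrow> (\<integral>\<^sup>+x. 0 \<partial>(lborel :: 'a measure))"
    unfolding Lp_on_def
  proof (rule nn_integral_dominated_convergence[where w = "\<lambda>\<xi>. ennreal (norm (2 * F \<xi>) powr p) * indicator UNIV \<xi>"])
    show "(\<integral>\<^sup>+x. ennreal (norm (2 * F x) powr p) * indicator UNIV x \<partial>lborel) < \<infinity>"
      unfolding Lp_on_def[of p UNIV "\<lambda>\<xi>. 2 * F \<xi>", symmetric]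
      using fin Lp_on_cmult[of F UNIV p 2] by (simp add: ennreal_mult_less_top)
    fix j
    show "AE x in lborel. ennreal (norm ((\<psi> (r j *\<^sub>R x) - 1) * F x) powr p) * indicator UNIV x \<le>
       ennreal (norm (2 * F x) powr p) * indicator UNIV x"
    proof (rule AE_I2)
      fix x
      have "norm (\<psi> (r j *\<^sub>R x) - 1) \<le> 1 + 1"
        by (rule norm_triangle_le_diff) (simp add: norm_\<psi>_le)
      then show "ennreal (norm ((\<psi> (r j *\<^sub>R x) - 1) * F x) powr p) * indicator UNIV x \<le>
       ennreal (norm (2 * F x) powr p) * indicator UNIV x"
        using p_gt_2 by (auto intro!: ennreal_leI powr_mono2 mult_right_mono simp: norm_mult)
    qed
  next
    show "AE x in lborel. (\<lambda>i. ennreal (norm ((\<psi> (r i *\<^sub>R x) - 1) * F x) powr p) * indicator UNIV x) \<longlonglongrightarrow> 0"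
    proof (rule AE_I2)
      fix x
      have "(\<lambda>i. norm ((\<psi> (r i *\<^sub>R x) - 1) * F x)) \<longlonglongrightarrow> norm ((1 - 1) * F x)"
        by (intro tendsto_intros tendsto_\<psi> r)
      then have "(\<lambda>i. norm ((\<psi> (r i *\<^sub>R x) - 1) * F x)) \<longlonglongrightarrow> 0" by simp
      then have "(\<lambda>i. norm ((\<psi> (r i *\<^sub>R x) - 1) * F x) powr p) \<longlonglongrightarrow> 0 powr p"
        using p_gt_2 by (intro tendsto_powr2) auto
      then show "(\<lambda>i. ennreal (norm ((\<psi> (r i *\<^sub>R x) - 1) * F x) powr p) * indicator UNIV x) \<longlonglongrightarrow> 0"
        using tendsto_ennrealI by fastforce
    qed
  qed auto
  then show ?thesis by simp
qed

text \<open>The error is a damped sampling error plus the blur of the old state. Globally the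
  scaling of \<open>\<psi>\<close> yields \<open>r^(-d) N^(-p/2)\<close>, which depends on
  \<open>A\<close> alone; on \<open>B\<close> the bound is a multiple of \<open>N^(-p/2)\<close>,
  which tends to 0. This second bound is what permits frequency separation.\<close>

lemma single_scale:
  assumes M: "0 < M" and \<delta>: "\<And>i. 0 \<le> \<delta> i" and fin: "Lp_on p UNIV (state_ft M y \<delta>) < \<infinity>"
    and A: "0 < A" "A \<le> 1" and \<rho>: "0 < \<rho>" and B [measurable]: "B \<in> sets borel"
    and finB: "emeasure lborel B < \<infinity>" and \<eta>: "0 < \<eta>"
  shows "\<exists>L r x. 0 < L \<and> 0 < r \<and> r \<le> \<rho> \<and> real (M * L) * r powr \<alpha> = A \<and>
    (\<forall>i<M. \<forall>l<L. norm (x i l - y i) \<le> \<delta> i) \<and>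
    Lp_on p UNIV (\<lambda>\<xi>. piece_ft M L x r \<xi> - state_ft M y \<delta> \<xi>)
      \<le> ennreal (err_const * A powr (- p / 2)) \<and>
    Lp_on p B (\<lambda>\<xi>. piece_ft M L x r \<xi> - state_ft M y \<delta> \<xi>)
      \<le> ennreal \<eta>"
proof -
  have p0: "p > 0" using p_gt_2 by simp
  define F where "F = state_ft M y \<delta>"
  have F [measurable]: "F \<in> borel_measurable borel" by (simp add: F_def)
  define q where "q = 2 powr (p - 1)"
  have q: "q > 0" by (simp add: q_def)
  define \<beta> where "\<beta> = measure lborel B"
  have \<beta>: "emeasure lborel B = ennreal \<beta>" "0 \<le> \<beta>"
    using finB by (auto simp: \<beta>_def emeasure_eq_ennreal_measure)
  define Q where "Q L = moment_const * real (M * L) powr (- p / 2) * (bump_norm + 1)" for L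
  \<comment> \<open>The radius solving \<open>real (M * L) * r powr \<alpha> = A\<close>; thus
    \<open>L\<close> is the only free parameter, and it is taken large.\<close>
  define rr where "rr L = (A / real (M * L)) powr (1 / \<alpha>)" for L
  \<comment> \<open>The blur has to be at most 1 for the global estimate and at most
    \<open>\<eta> / (2 * q)\<close> for the one on \<open>B\<close>.\<close>
  define \<kappa> where "\<kappa> = min 1 (\<eta> / (2 * q))"
  have \<kappa>: "\<kappa> > 0" using \<eta> q by (simp add: \<kappa>_def)
  have lim: "filterlim (\<lambda>L. real (M * L)) at_top sequentially"
    using M by (simp add: filterlim_real_sequentially filterlim_tendsto_pos_mult_at_top[OF tendsto_const])
  have "(\<lambda>L. A / real (M * L)) \<longlonglongrightarrow> 0"
    using lim by (intro tendsto_divide_0[OF tendsto_const] filterlim_at_top_imp_at_infinity)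
  then have "rr \<longlonglongrightarrow> 0 powr (1 / \<alpha>)"
    unfolding rr_def using \<alpha>_pos A by (intro tendsto_powr2) auto
  then have rr0: "rr \<longlonglongrightarrow> 0" by simp
  have "(\<lambda>L. real (M * L) powr (- p / 2)) \<longlonglongrightarrow> 0"
    using lim p0 by (intro tendsto_neg_powr) auto
  then have "(\<lambda>L. q * ((1 + \<beta>) * (moment_const * real (M * L) powr (- p / 2) * (bump_norm + 1)))) \<longlonglongrightarrow>
     q * ((1 + \<beta>) * (moment_const * 0 * (bump_norm + 1)))"
    by (intro tendsto_intros)
  then have Q0: "(\<lambda>L. q * ((1 + \<beta>) * Q L)) \<longlonglongrightarrow> 0" by (simp add: Q_def)
  have "\<forall>\<^sub>F L in sequentially. L > 0 \<and> rr L < \<rho> \<and> q * ((1 + \<beta>) * Q L) < \<eta> / 2 \<and>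
      Lp_on p UNIV (\<lambda>\<xi>. (\<psi> (rr L *\<^sub>R \<xi>) - 1) * F \<xi>) < ennreal \<kappa>"
    using \<rho> \<eta> \<kappa> fin
    by (intro eventually_conj eventually_gt_at_top order_tendstoD(2)[OF rr0] order_tendstoD(2)[OF Q0]
        order_tendstoD(2)[OF Lp_on_blur_tendsto_0[OF F _ rr0]]) (auto simp: F_def)
  then obtain L where L: "L > 0" and r\<rho>: "rr L < \<rho>" and QL: "q * ((1 + \<beta>) * Q L) < \<eta> / 2"
     and bl: "Lp_on p UNIV (\<lambda>\<xi>. (\<psi> (rr L *\<^sub>R \<xi>) - 1) * F \<xi>) < ennreal \<kappa>"
    by (auto simp: eventually_sequentially)
  define r where "r = rr L"
  define N where "N = M * L"
  have N: "N > 0" using M L by (simp add: N_def)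
  have r: "r > 0" using A N by (simp add: r_def rr_def N_def[symmetric])
  have ra: "real N * r powr \<alpha> = A"
    using A N \<alpha>_pos by (simp add: r_def rr_def N_def[symmetric] powr_powr del: of_nat_mult)
  have "r powr \<alpha> = A / real N" using ra N by (simp add: field_simps)
  then have rd: "r ^ DIM('a) = (A / real N) powr (p / 2)"
    using r p0 by (simp add: powr_realpow[symmetric] powr_powr \<alpha>_eq flip: \<open>r powr \<alpha> = A / real N\<close>)
  \<comment> \<open>The two summands control the error globally and, for large \<open>N\<close>, on \<open>B\<close>.\<close>
  define w where "w \<xi> = ennreal (r ^ DIM('a)) * ennreal (norm (\<psi> (r *\<^sub>R \<xi>)) powr p) + ennreal (1 / (1 + \<beta>)) * indicator B \<xi>" for \<xi>
  have [measurable]: "w \<in> borel_measurable borel" unfolding w_def[abs_def] by measurable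
  have "(\<integral>\<^sup>+\<xi>. w \<xi> \<partial>lborel) = ennreal bump_norm + ennreal (1 / (1 + \<beta>)) * ennreal \<beta>"
    unfolding w_def using nn_integral_lborel_scaleR[of "\<lambda>\<xi>. ennreal (norm (\<psi> \<xi>) powr p)" r] r
    by (subst nn_integral_add) (auto simp: nn_integral_cmult bump_norm \<beta>(1)[symmetric])
  also have "\<dots> = ennreal (bump_norm + \<beta> / (1 + \<beta>))"
    using bump_norm \<beta> by (simp flip: ennreal_mult ennreal_plus)
  also have "\<dots> \<le> ennreal (bump_norm + 1)"
    using \<beta>(2) by (intro ennreal_leI add_left_mono) (simp add: divide_simps)
  finally have w: "(\<integral>\<^sup>+\<xi>. w \<xi> \<partial>lborel) \<le> ennreal (bump_norm + 1)" .
  \<comment> \<open>Sample \<open>j\<close> belongs to parent \<open>j div L\<close>, so each parent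
    receives exactly \<open>L\<close> points.\<close>
  obtain X where X: "(\<forall>j<N. norm (X j - y (j div L)) \<le> \<delta> (j div L)) \<and>
    (\<integral>\<^sup>+\<xi>. w \<xi> * ennreal (norm ((\<Sum>j<N. dev (y (j div L)) (\<delta> (j div L)) (X j) \<xi>) / of_nat N) powr p) \<partial>lborel) \<le>
    ennreal (moment_const * real N powr (- p / 2)) * (\<integral>\<^sup>+\<xi>. w \<xi> \<partial>lborel)"
    using exists_samples[where w = w and N = N and r = "\<lambda>j. \<delta> (j div L)" and y = "\<lambda>j. y (j div L)"] N \<delta> by auto
  define P where "P \<xi> = (\<Sum>j<N. dev (y (j div L)) (\<delta> (j div L)) (X j) \<xi>) / of_nat N" for \<xi>
  have [measurable]: "P \<in> borel_measurable borel" unfolding P_def[abs_def] by measurable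
  have "(\<integral>\<^sup>+\<xi>. w \<xi> * ennreal (norm (P \<xi>) powr p) \<partial>lborel) \<le>
     ennreal (moment_const * real N powr (- p / 2)) * ennreal (bump_norm + 1)"
    unfolding P_def by (rule order_trans[OF conjunct2[OF X] mult_left_mono[OF w]]) simp
  also have "\<dots> = ennreal (Q L)"
    unfolding Q_def N_def using moment_const_pos bump_norm(2) by (intro ennreal_mult[symmetric]) auto
  also have "(\<integral>\<^sup>+\<xi>. w \<xi> * ennreal (norm (P \<xi>) powr p) \<partial>lborel) =
      ennreal (r ^ DIM('a)) * Lp_on p UNIV (\<lambda>\<xi>. \<psi> (r *\<^sub>R \<xi>) * P \<xi>) + ennreal (1 / (1 + \<beta>)) * Lp_on p B P"
    unfolding Lp_on_def using r
    by (subst (1 2) nn_integral_cmult[symmetric]; (subst nn_integral_add[symmetric])?)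
      (auto intro!: nn_integral_cong simp: w_def distrib_left distrib_right norm_mult powr_mult ennreal_mult mult_ac)
  finally have PQ: "ennreal (r ^ DIM('a)) * Lp_on p UNIV (\<lambda>\<xi>. \<psi> (r *\<^sub>R \<xi>) * P \<xi>) + ennreal (1 / (1 + \<beta>)) * Lp_on p B P \<le> ennreal (Q L)" .
  have Q: "Q L \<ge> 0" using moment_const_pos bump_norm by (simp add: Q_def)
  have P1: "Lp_on p UNIV (\<lambda>\<xi>. \<psi> (r *\<^sub>R \<xi>) * P \<xi>) \<le> ennreal (moment_const * (bump_norm + 1) * A powr (- p / 2))"
  proof -
    have "Lp_on p UNIV (\<lambda>\<xi>. \<psi> (r *\<^sub>R \<xi>) * P \<xi>) = ennreal (1 / r ^ DIM('a)) * (ennreal (r ^ DIM('a)) * Lp_on p UNIV (\<lambda>\<xi>. \<psi> (r *\<^sub>R \<xi>) * P \<xi>))"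
      using r by (simp add: mult.assoc[symmetric] flip: ennreal_mult)
    also have "\<dots> \<le> ennreal (1 / r ^ DIM('a)) * ennreal (Q L)"
      using PQ by (intro mult_left_mono) (auto intro: order_trans[OF add_increasing2])
    also have "\<dots> = ennreal (Q L / r ^ DIM('a))"
      using Q r by (simp flip: ennreal_mult)
    also have "Q L / r ^ DIM('a) = moment_const * (bump_norm + 1) * A powr (- p / 2)"
      unfolding rd Q_def N_def[symmetric] using A N by (simp add: powr_divide powr_minus field_simps)
    finally show ?thesis .
  qed
  have P2: "Lp_on p B (\<lambda>\<xi>. \<psi> (r *\<^sub>R \<xi>) * P \<xi>) \<le> ennreal ((1 + \<beta>) * Q L)"
  proof -
    have "Lp_on p B (\<lambda>\<xi>. \<psi> (r *\<^sub>R \<xi>) * P \<xi>) \<le> Lp_on p B P"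
      using p0 by (intro Lp_on_mono) (auto simp: norm_mult norm_\<psi>_le mult_left_le_one_le)
    also have "\<dots> = ennreal (1 + \<beta>) * (ennreal (1 / (1 + \<beta>)) * Lp_on p B P)"
      unfolding mult.assoc[symmetric] using \<beta>(2) by (subst ennreal_mult[symmetric]) auto
    also have "\<dots> \<le> ennreal (1 + \<beta>) * ennreal (Q L)"
      using PQ by (intro mult_left_mono) (auto intro: order_trans[OF add_increasing])
    also have "\<dots> = ennreal ((1 + \<beta>) * Q L)"
      using Q \<beta>(2) by (intro ennreal_mult[symmetric]) auto
    finally show ?thesis .
  qed
  define x where "x i l = X (l + i * L)" for i l
  define E where "E \<xi> = piece_ft M L x r \<xi> - state_ft M y \<delta> \<xi>" for \<xi>
  \<comment> \<open>\<open>P\<close> is the mean of the sampled characters minus \<open>F\<close>.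
    Multiplying by \<open>\<psi> (r *\<^sub>R \<xi>)\<close> produces the new state but also damps
    the subtracted \<open>F\<close>; the second summand corrects this.\<close>
  have E: "E \<xi> = \<psi> (r *\<^sub>R \<xi>) * P \<xi> + (\<psi> (r *\<^sub>R \<xi>) - 1) * F \<xi>" for \<xi>
  proof -
    have 1: "(\<Sum>i<M. \<Sum>l<L. cell_ft (x i l) r \<xi>) = \<psi> (r *\<^sub>R \<xi>) * (\<Sum>j<N. fchar (X j) \<xi>)"
      unfolding N_def sum_mult_product sum_distrib_left by (simp add: x_def cell_ft_def mult.commute)
    have "(\<Sum>j<N. cell_ft (y (j div L)) (\<delta> (j div L)) \<xi>) = of_nat L * (\<Sum>i<M. cell_ft (y i) (\<delta> i) \<xi>)"
      unfolding N_def sum_mult_product sum_distrib_left using L by simp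
    also have "\<dots> = of_nat N * F \<xi>"
      using M by (simp add: F_def state_ft_def N_def)
    finally have 2: "P \<xi> = (\<Sum>j<N. fchar (X j) \<xi>) / of_nat N - F \<xi>"
      using N by (simp add: P_def dev_def sum_subtractf diff_divide_distrib)
    show ?thesis
      unfolding E_def piece_ft_def 1 2 F_def[symmetric] N_def[symmetric] by (simp add: algebra_simps)
  qed
  have "Lp_on p UNIV E \<le> ennreal q * (ennreal (moment_const * (bump_norm + 1) * A powr (- p / 2)) + ennreal 1)"
  proof -
    have "Lp_on p UNIV E \<le> ennreal q * (Lp_on p UNIV (\<lambda>\<xi>. \<psi> (r *\<^sub>R \<xi>) * P \<xi>) + Lp_on p UNIV (\<lambda>\<xi>. (\<psi> (r *\<^sub>R \<xi>) - 1) * F \<xi>))"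
      unfolding E[abs_def] q_def by (rule Lp_on_add_half) measurable
    moreover have "Lp_on p UNIV (\<lambda>\<xi>. (\<psi> (r *\<^sub>R \<xi>) - 1) * F \<xi>) \<le> ennreal 1"
      using bl unfolding r_def by (rule order_trans[OF less_imp_le ennreal_leI]) (simp add: \<kappa>_def)
    ultimately show ?thesis
      using P1 by (meson add_mono mult_left_mono order_trans zero_le)
  qed
  also have "\<dots> = ennreal (q * (moment_const * (bump_norm + 1) * A powr (- p / 2) + 1))"
    using q moment_const_pos bump_norm by (simp add: ennreal_mult ennreal_plus)
  also have "\<dots> \<le> ennreal (err_const * A powr (- p / 2))"
  proof (rule ennreal_leI)
    \<comment> \<open>Here \<open>A \<le> 1\<close> enters: the additive 1 from the blur is absorbed
      into the constant.\<close>
    have "1 \<le> A powr (- p / 2)"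
      using A p0 powr_mono'[of "- p / 2" 0 A] by simp
    then show "q * (moment_const * (bump_norm + 1) * A powr (- p / 2) + 1) \<le> err_const * A powr (- p / 2)"
      using q by (simp add: err_const_def q_def[symmetric] algebra_simps)
  qed
  finally have E1: "Lp_on p UNIV E \<le> ennreal (err_const * A powr (- p / 2))" .
  have "Lp_on p B E \<le> ennreal q * (ennreal ((1 + \<beta>) * Q L) + ennreal (\<eta> / (2 * q)))"
  proof -
    have "Lp_on p B E \<le> ennreal q * (Lp_on p B (\<lambda>\<xi>. \<psi> (r *\<^sub>R \<xi>) * P \<xi>) + Lp_on p B (\<lambda>\<xi>. (\<psi> (r *\<^sub>R \<xi>) - 1) * F \<xi>))"
      unfolding E[abs_def] q_def by (rule Lp_on_add_half) measurable
    moreover have "Lp_on p B (\<lambda>\<xi>. (\<psi> (r *\<^sub>R \<xi>) - 1) * F \<xi>) \<le> Lp_on p UNIV (\<lambda>\<xi>. (\<psi> (r *\<^sub>R \<xi>) - 1) * F \<xi>)"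
      using p0 by (intro Lp_on_mono) auto
    moreover have "Lp_on p UNIV (\<lambda>\<xi>. (\<psi> (r *\<^sub>R \<xi>) - 1) * F \<xi>) \<le> ennreal (\<eta> / (2 * q))"
      using bl unfolding r_def by (rule order_trans[OF less_imp_le ennreal_leI]) (simp add: \<kappa>_def)
    ultimately show ?thesis
      using P2 by (meson add_mono mult_left_mono order_trans zero_le)
  qed
  also have "\<dots> = ennreal (q * ((1 + \<beta>) * Q L) + \<eta> / 2)"
    using q Q \<beta>(2) \<eta> by (simp add: algebra_simps flip: ennreal_mult ennreal_plus)
  also have "\<dots> \<le> ennreal \<eta>" using QL by (intro ennreal_leI) linarith
  finally have E2: "Lp_on p B E \<le> ennreal \<eta>" .
  have "norm (x i l - y i) \<le> \<delta> i" if "i < M" "l < L" for i l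
  proof -
    have "l + i * L < L + i * L" using that by simp
    also have "\<dots> = Suc i * L" by simp
    also have "\<dots> \<le> N" unfolding N_def using that by (intro mult_le_mono1) simp
    finally show ?thesis
      using conjunct1[OF X, rule_format, of "l + i * L"] that by (simp add: x_def)
  qed
  then show ?thesis
    using L r r\<rho> ra E1 E2 unfolding E_def N_def
    by (intro exI[of _ L] exI[of _ r] exI[of _ x] conjI) (auto simp: r_def)
qed

section \<open>Superposing many scales\<close>

text \<open>All pieces replace the same parent state. Each new scale is chosen after the accumulated
  error \<open>G\<close> is known and is small on the ball carrying most of \<open>G\<close>. Hence
  the bound grows linearly in \<open>K\<close>, whereas the triangle inequality would give
  \<open>K powr p\<close>.\<close>

lemma many_scales:
  assumes M: "0 < M" and \<delta>: "\<And>i. 0 \<le> \<delta> i" and fin: "Lp_on p UNIV (state_ft M y \<delta>) < \<infinity>"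
    and A: "0 < A" "A \<le> 1" and \<rho>: "0 < \<rho>"
  shows "\<exists>L r x. (\<forall>k<K. 0 < L k \<and> 0 < r k \<and> r k \<le> \<rho> \<and> real (M * L k) * r k powr \<alpha> = A \<and>
      (\<forall>i<M. \<forall>l<L k. norm (x k i l - y i) \<le> \<delta> i)) \<and>
    Lp_on p UNIV (\<lambda>\<xi>. \<Sum>k<K. piece_ft M (L k) (x k) (r k) \<xi> - state_ft M y \<delta> \<xi>)
      \<le> ennreal (real K * (err_const * A powr (- p / 2) + 1))"
proof (induction K)
  case 0
  show ?case using p_gt_2 by (simp add: Lp_on_def)
next
  case (Suc K)
  define c where "c = err_const * A powr (- p / 2)"
  have c: "c \<ge> 0" using err_const_pos by (simp add: c_def)
  obtain L r x where IH: "\<And>k. k < K \<Longrightarrow> 0 < L k \<and> 0 < r k \<and> r k \<le> \<rho> \<and> real (M * L k) * r k powr \<alpha> = A \<and>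
      (\<forall>i<M. \<forall>l<L k. norm (x k i l - y i) \<le> \<delta> i)"
    and LpG: "Lp_on p UNIV (\<lambda>\<xi>. \<Sum>k<K. piece_ft M (L k) (x k) (r k) \<xi> - state_ft M y \<delta> \<xi>)
      \<le> ennreal (real K * (c + 1))"
    using Suc unfolding c_def by blast
  define G where "G \<xi> = (\<Sum>k<K. piece_ft M (L k) (x k) (r k) \<xi> - state_ft M y \<delta> \<xi>)" for \<xi>
  have G: "G \<in> borel_measurable borel" unfolding G_def[abs_def] by measurable
  have "Lp_on p UNIV G < \<infinity>" using LpG unfolding G_def[abs_def] by (rule order.strict_trans1) simp
  from Lp_on_add_almost_disjoint[OF G this c] p_gt_2 obtain n :: nat and \<eta> where \<eta>: "\<eta> > 0"
    and ad: "\<And>e. e \<in> borel_measurable borel \<Longrightarrow> Lp_on p UNIV e \<le> ennreal c \<Longrightarrow>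
      Lp_on p (ball 0 (real n)) e \<le> ennreal \<eta> \<Longrightarrow>
      Lp_on p UNIV (\<lambda>\<xi>. G \<xi> + e \<xi>) \<le> Lp_on p UNIV G + ennreal (c + 1)" by auto
  obtain L' r' x' where new: "0 < L'" "0 < r'" "r' \<le> \<rho>" "real (M * L') * r' powr \<alpha> = A"
     "\<forall>i<M. \<forall>l<L'. norm (x' i l - y i) \<le> \<delta> i"
     "Lp_on p UNIV (\<lambda>\<xi>. piece_ft M L' x' r' \<xi> - state_ft M y \<delta> \<xi>) \<le> ennreal c"
     "Lp_on p (ball 0 (real n)) (\<lambda>\<xi>. piece_ft M L' x' r' \<xi> - state_ft M y \<delta> \<xi>) \<le> ennreal \<eta>"
    using single_scale[OF M \<delta> fin A \<rho> _ emeasure_bounded_finite \<eta>, of "ball 0 (real n)"]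
    unfolding c_def by (auto simp del: of_nat_mult)
  have "Lp_on p UNIV (\<lambda>\<xi>. G \<xi> + (piece_ft M L' x' r' \<xi> - state_ft M y \<delta> \<xi>)) \<le> Lp_on p UNIV G + ennreal (c + 1)"
    by (rule ad[OF _ new(6,7)]) measurable
  also have "\<dots> \<le> ennreal (real K * (c + 1)) + ennreal (c + 1)"
    using LpG unfolding G_def[abs_def] by (rule add_right_mono)
  also have "\<dots> = ennreal (real (Suc K) * (c + 1))"
    using c by (simp add: algebra_simps flip: ennreal_plus)
  finally have "Lp_on p UNIV (\<lambda>\<xi>. G \<xi> + (piece_ft M L' x' r' \<xi> - state_ft M y \<delta> \<xi>)) \<le> ennreal (real (Suc K) * (c + 1))" .
  moreover have "(\<lambda>\<xi>. G \<xi> + (piece_ft M L' x' r' \<xi> - state_ft M y \<delta> \<xi>)) =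
    (\<lambda>\<xi>. \<Sum>k<Suc K. piece_ft M ((L(K := L')) k) ((x(K := x')) k) ((r(K := r')) k) \<xi> - state_ft M y \<delta> \<xi>)"
    by (simp add: G_def fun_eq_iff)
  ultimately show ?case
    using IH new(1-5) unfolding c_def[symmetric]
    by (intro exI[of _ "L(K := L')"] exI[of _ "r(K := r')"] exI[of _ "x(K := x')"]) (auto simp: less_Suc_eq)
qed

text \<open>Lets families with different numbers of points be listed with one common length without
  changing their averages.\<close>

lemma sum_mod_periodic:
  fixes g :: "nat \<Rightarrow> complex"
  assumes "b dvd n" "0 < b" "0 < n"
  shows "(\<Sum>l<n. g (l mod b)) / of_nat n = (\<Sum>l<b. g l) / of_nat b"
proof -
  obtain q where "n = b * q" using assms(1) ..
  then have n: "n = q * b" by simp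
  show ?thesis
    unfolding n sum_mult_product using assms(2,3) by (simp add: n)
qed

text \<open>The order of choice matters: \<open>t\<close> is fixed first, so that the old state
  grows by at most \<open>\<epsilon> / 2\<close>; then \<open>K\<close> is taken large enough to
  beat the possibly huge but fixed factor \<open>t powr (1 - p)\<close>.\<close>

lemma exists_parameters:
  assumes "0 \<le> I" "0 < \<epsilon>"
  shows "\<exists>t K A. 0 < t \<and> t < 1 \<and> 0 < K \<and> 0 < A \<and> A \<le> 1 \<and> real K * A \<le> \<epsilon> \<and>
    (1 - t) powr (1 - p) * I + t powr (1 - p) * ((1 / real K) powr p * (real K * (err_const * A powr (- p / 2) + 1))) \<le> I + \<epsilon>"
proof -
  have "((\<lambda>t. (1 - t) powr (1 - p) * I) \<longlongrightarrow> (1 - 0) powr (1 - p) * I) (at_right 0)"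
    by (intro tendsto_intros) auto
  then have "\<forall>\<^sub>F t in at_right 0. (1 - t) powr (1 - p) * I < I + \<epsilon> / 2"
    by (rule order_tendstoD) (use assms in simp)
  moreover have "\<forall>\<^sub>F t in at_right (0::real). 0 < t \<and> t < 1"
    by (auto simp: eventually_at_right_field intro!: exI[of _ 1])
  ultimately have "\<forall>\<^sub>F t in at_right (0::real). (1 - t) powr (1 - p) * I < I + \<epsilon> / 2 \<and> 0 < t \<and> t < 1"
    by eventually_elim simp
  then obtain t where t: "(1 - t) powr (1 - p) * I < I + \<epsilon> / 2" "0 < t" "t < 1"
    using eventually_happens'[OF trivial_limit_at_right_real] by blast
  \<comment> \<open>The midpoint of the interval from 1 to \<open>2 - 2 / p\<close>, which is
    nonempty because \<open>p > 2\<close>.\<close>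
  define s where "s = 3 / 2 - 1 / p"
  have s: "s > 1" "1 - p + s * p / 2 < 0"
    using p_gt_2 by (auto simp: s_def field_simps)
  have lim: "(\<lambda>K. real K powr c) \<longlonglongrightarrow> 0" if "c < 0" for c
    using that filterlim_real_sequentially by (intro tendsto_neg_powr)
  have "(\<lambda>K. t powr (1 - p) * (err_const * real K powr (1 - p + s * p / 2) + real K powr (1 - p))) \<longlonglongrightarrow>
     t powr (1 - p) * (err_const * 0 + 0)"
    using s p_gt_2 by (intro tendsto_intros lim) auto
  then have "\<forall>\<^sub>F K in sequentially. t powr (1 - p) * (err_const * real K powr (1 - p + s * p / 2) + real K powr (1 - p)) < \<epsilon> / 2"
    by (rule order_tendstoD) (use assms in simp)
  moreover have "\<forall>\<^sub>F K in sequentially. real K powr (1 - s) < \<epsilon>"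
    using lim[of "1 - s"] s assms by (intro order_tendstoD) auto
  ultimately have "\<forall>\<^sub>F K in sequentially. K > 0 \<and> real K powr (1 - s) < \<epsilon> \<and>
     t powr (1 - p) * (err_const * real K powr (1 - p + s * p / 2) + real K powr (1 - p)) < \<epsilon> / 2"
    using eventually_gt_at_top[of 0] by eventually_elim simp
  then obtain K where K: "K > 0" "real K powr (1 - s) < \<epsilon>"
     "t powr (1 - p) * (err_const * real K powr (1 - p + s * p / 2) + real K powr (1 - p)) < \<epsilon> / 2"
    by (auto simp: eventually_sequentially)
  define A where "A = real K powr (- s)"
  have A: "A > 0" "A \<le> 1"
    using K(1) s powr_mono[of "- s" 0 "real K"] by (auto simp: A_def)
  have "real K * A = real K powr (1 - s)"
    using K(1) by (simp add: A_def powr_diff powr_minus field_simps)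
  moreover have "(1 / real K) powr p * (real K * (err_const * A powr (- p / 2) + 1)) =
      err_const * real K powr (1 - p + s * p / 2) + real K powr (1 - p)"
  proof -
    have "A powr (- p / 2) = real K powr (s * p / 2)"
      by (simp add: A_def powr_powr)
    moreover have "(1 / real K) powr p * real K = real K powr (1 - p)"
      using K(1) by (simp add: powr_divide powr_diff)
    ultimately show ?thesis
      unfolding mult.assoc[symmetric] by (simp add: distrib_left powr_add)
  qed
  ultimately show ?thesis
    using t K A by (intro exI[of _ t] exI[of _ K] exI[of _ A]) auto
qed

text \<open>The new state averages the \<open>K\<close> replacements, so it differs from the old one
  by \<open>1 / K\<close> times the summed errors. The covering sum runs over the set of distinct
  balls, not over indices, so repeated balls are counted once.\<close>

lemma refine:
  assumes M: "0 < M" and \<delta>: "\<And>i. 0 < \<delta> i" and fin: "Lp_on p UNIV (state_ft M y \<delta>) < \<infinity>"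
    and \<epsilon>: "0 < \<epsilon>"
  shows "\<exists>L y' \<delta>'. 0 < L \<and> (\<forall>j. 0 < \<delta>' j) \<and>
    (\<forall>j<M * L. norm (y' j - y (j div L)) \<le> \<delta> (j div L) \<and> \<delta>' j \<le> \<epsilon> \<and> \<delta>' j \<le> \<delta> (j div L) / 2) \<and>
    (\<Sum>q\<in>(\<lambda>j. (y' j, \<delta>' j)) ` {..<M * L}. snd q powr \<alpha>) \<le> \<epsilon> \<and>
    Lp_on p UNIV (state_ft (M * L) y' \<delta>') \<le> Lp_on p UNIV (state_ft M y \<delta>) + ennreal \<epsilon>"
proof -
  define F where "F = state_ft M y \<delta>"
  have F [measurable]: "F \<in> borel_measurable borel" by (simp add: F_def)
  define I where "I = enn2real (Lp_on p UNIV F)"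
  have I: "Lp_on p UNIV F = ennreal I" "0 \<le> I" using fin by (auto simp: I_def F_def)
  obtain t K A where t: "0 < t" "t < 1" and K: "0 < K" and A: "0 < A" "A \<le> 1" and KA: "real K * A \<le> \<epsilon>"
    and tKA: "(1 - t) powr (1 - p) * I + t powr (1 - p) * ((1 / real K) powr p * (real K * (err_const * A powr (- p / 2) + 1))) \<le> I + \<epsilon>"
    using exists_parameters[OF I(2) \<epsilon>] by blast
  \<comment> \<open>One bound on the new radii that secures both smallness and halving relative to
    every parent.\<close>
  define \<rho> where "\<rho> = Min (insert \<epsilon> ((\<lambda>i. \<delta> i / 2) ` {..<M}))"
  have \<rho>: "0 < \<rho>" "\<rho> \<le> \<epsilon>"
    using \<epsilon> \<delta> by (auto simp: \<rho>_def)
  have \<rho>\<delta>: "\<rho> \<le> \<delta> i / 2" if "i < M" for i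
    unfolding \<rho>_def by (rule Min_le) (use that in auto)
  obtain Ls r x where pieces: "\<And>k. k < K \<Longrightarrow> 0 < Ls k \<and> 0 < r k \<and> r k \<le> \<rho> \<and> real (M * Ls k) * r k powr \<alpha> = A \<and>
      (\<forall>i<M. \<forall>l<Ls k. norm (x k i l - y i) \<le> \<delta> i)"
    and LpS: "Lp_on p UNIV (\<lambda>\<xi>. \<Sum>k<K. piece_ft M (Ls k) (x k) (r k) \<xi> - F \<xi>)
      \<le> ennreal (real K * (err_const * A powr (- p / 2) + 1))"
    using many_scales[OF M less_imp_le[OF \<delta>] fin A \<rho>(1), of K] unfolding F_def by blast
  \<comment> \<open>A common multiple of the numbers of children at the different scales.\<close>
  define T where "T = (\<Prod>k<K. Ls k)"
  have T: "0 < T" using pieces by (auto simp: T_def intro!: prod_pos)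
  have dvd: "Ls k dvd T" if "k < K" for k using that by (auto simp: T_def)
  \<comment> \<open>\<open>j = l + (k + i * K) * T\<close> indexes cell \<open>i\<close>, scale \<open>k\<close>; the \<open>Ls k\<close> points of that scale are repeated
    periodically in \<open>l\<close> so that every scale gets the same weight.\<close>
  define y' where "y' j = (let m = j mod (K * T); k = m div T in x k (j div (K * T)) (m mod T mod Ls k))" for j
  define \<delta>' where "\<delta>' j = r (j mod (K * T) div T)" for j
  have KT: "0 < K * T" using K T by simp
  have kK: "j mod (K * T) div T < K" for j
    using KT by (simp add: less_mult_imp_div_less)
  have pos: "0 < \<delta>' j" for j using pieces[OF kK] by (simp add: \<delta>'_def)
  have close: "norm (y' j - y (j div (K * T))) \<le> \<delta> (j div (K * T)) \<and> \<delta>' j \<le> \<epsilon> \<and> \<delta>' j \<le> \<delta> (j div (K * T)) / 2"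
    if "j < M * (K * T)" for j
  proof -
    have i: "j div (K * T) < M" using that by (rule less_mult_imp_div_less)
    show ?thesis
      using pieces[OF kK[of j]] \<rho>(2) \<rho>\<delta>[OF i] i by (auto simp: y'_def \<delta>'_def Let_def intro: order_trans)
  qed
  have cover: "(\<Sum>q\<in>(\<lambda>j. (y' j, \<delta>' j)) ` {..<M * (K * T)}. snd q powr \<alpha>) \<le> \<epsilon>"
  proof -
    define S where "S = (SIGMA k:{..<K}. {..<M} \<times> {..<Ls k})"
    define f where "f = (\<lambda>(k, i, l). (x k i l, r k))"
    have fS: "finite S" by (auto simp: S_def)
    \<comment> \<open>Without repetitions there are at most \<open>M * Ls k\<close> balls at scale
      \<open>k\<close>; these contribute at most \<open>A\<close>, whatever \<open>T\<close>
      is.\<close>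
    have "(\<lambda>j. (y' j, \<delta>' j)) ` {..<M * (K * T)} \<subseteq> f ` S"
    proof (clarsimp)
      fix j assume "j < M * (K * T)"
      then have i: "j div (K * T) < M" by (rule less_mult_imp_div_less)
      define k where "k = j mod (K * T) div T"
      have "k < K" using kK by (simp add: k_def)
      then show "(y' j, \<delta>' j) \<in> f ` S"
        using i pieces[of k]
        by (intro image_eqI[of _ _ "(k, j div (K * T), j mod (K * T) mod T mod Ls k)"])
          (auto simp: f_def S_def y'_def \<delta>'_def Let_def k_def)
    qed
    then have "(\<Sum>q\<in>(\<lambda>j. (y' j, \<delta>' j)) ` {..<M * (K * T)}. snd q powr \<alpha>) \<le> (\<Sum>q\<in>f ` S. snd q powr \<alpha>)"
      using fS by (intro sum_mono2) auto
    also have "\<dots> \<le> sum ((\<lambda>q. snd q powr \<alpha>) \<circ> f) S"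
      using fS by (intro sum_image_le) auto
    also have "\<dots> = (\<Sum>k<K. \<Sum>z\<in>{..<M} \<times> {..<Ls k}. r k powr \<alpha>)"
      unfolding S_def by (subst sum.Sigma) (auto simp: f_def intro!: sum.cong)
    also have "\<dots> = (\<Sum>k<K. A)"
      using pieces by (intro sum.cong) (auto simp: card_cartesian_product)
    finally show ?thesis using KA by simp
  qed
  define S where "S \<xi> = (\<Sum>k<K. piece_ft M (Ls k) (x k) (r k) \<xi> - F \<xi>)" for \<xi>
  have [measurable]: "S \<in> borel_measurable borel" unfolding S_def[abs_def] by measurable
  have eq: "state_ft (M * (K * T)) y' \<delta>' \<xi> = F \<xi> + 1 / of_nat K * S \<xi>" for \<xi>
  proof -
    have "(\<Sum>j<M * (K * T). cell_ft (y' j) (\<delta>' j) \<xi>) =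
       (\<Sum>i<M. \<Sum>m<K * T. cell_ft (x (m div T) i (m mod T mod Ls (m div T))) (r (m div T)) \<xi>)"
      unfolding sum_mult_product[of _ M] using KT
      by (intro sum.cong refl) (simp add: y'_def \<delta>'_def Let_def)
    also have "\<dots> = (\<Sum>i<M. \<Sum>k<K. \<Sum>l<T. cell_ft (x k i (l mod Ls k)) (r k) \<xi>)"
      unfolding sum_mult_product[of _ K] using T by (intro sum.cong refl) simp
    also have "\<dots> = (\<Sum>i<M. \<Sum>k<K. of_nat T * ((\<Sum>l<Ls k. cell_ft (x k i l) (r k) \<xi>) / of_nat (Ls k)))"
    proof (intro sum.cong refl)
      fix i k assume "k \<in> {..<K}"
      then have "(\<Sum>l<T. cell_ft (x k i (l mod Ls k)) (r k) \<xi>) / of_nat T = (\<Sum>l<Ls k. cell_ft (x k i l) (r k) \<xi>) / of_nat (Ls k)"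
        using pieces dvd T by (intro sum_mod_periodic) auto
      then show "(\<Sum>l<T. cell_ft (x k i (l mod Ls k)) (r k) \<xi>) = of_nat T * ((\<Sum>l<Ls k. cell_ft (x k i l) (r k) \<xi>) / of_nat (Ls k))"
        using T by (simp add: field_simps)
    qed
    also have "\<dots> = (\<Sum>k<K. of_nat T * (\<Sum>i<M. (\<Sum>l<Ls k. cell_ft (x k i l) (r k) \<xi>) / of_nat (Ls k)))"
      by (subst sum.swap) (simp add: sum_distrib_left)
    also have "\<dots> = (\<Sum>k<K. of_nat T * (of_nat M * piece_ft M (Ls k) (x k) (r k) \<xi>))"
      using M by (intro sum.cong refl) (simp add: piece_ft_def sum_divide_distrib[symmetric])
    also have "\<dots> = of_nat T * of_nat M * (\<Sum>k<K. piece_ft M (Ls k) (x k) (r k) \<xi>)"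
      by (simp add: sum_distrib_left mult.assoc)
    finally have "state_ft (M * (K * T)) y' \<delta>' \<xi> = (\<Sum>k<K. piece_ft M (Ls k) (x k) (r k) \<xi>) / of_nat K"
      using M T by (simp add: state_ft_def)
    then show ?thesis using K by (simp add: S_def sum_subtractf field_simps)
  qed
  have "Lp_on p UNIV (state_ft (M * (K * T)) y' \<delta>') = Lp_on p UNIV (\<lambda>\<xi>. F \<xi> + 1 / of_nat K * S \<xi>)"
    unfolding eq[abs_def, symmetric] ..
  \<comment> \<open>The old state receives the coefficient near 1. Averaging gives
    \<open>K powr (- p)\<close> on the other term, against only linear growth in
    \<open>LpS\<close>.\<close>
  also have "\<dots> \<le> ennreal ((1 - t) powr (1 - p)) * Lp_on p UNIV F +
      ennreal (t powr (1 - p)) * Lp_on p UNIV (\<lambda>\<xi>. 1 / of_nat K * S \<xi>)"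
    using t p_gt_2 by (intro Lp_on_add_le) auto
  also have "Lp_on p UNIV (\<lambda>\<xi>. 1 / of_nat K * S \<xi>) = ennreal ((1 / real K) powr p) * Lp_on p UNIV S"
    by (subst Lp_on_cmult) (auto simp: norm_divide)
  also have "ennreal ((1 - t) powr (1 - p)) * Lp_on p UNIV F + ennreal (t powr (1 - p)) * (ennreal ((1 / real K) powr p) * Lp_on p UNIV S)
     \<le> ennreal ((1 - t) powr (1 - p)) * ennreal I + ennreal (t powr (1 - p)) * (ennreal ((1 / real K) powr p) *
        ennreal (real K * (err_const * A powr (- p / 2) + 1)))"
    unfolding I(1) using LpS unfolding S_def by (intro add_mono mult_left_mono order_refl) auto
  also have "\<dots> = ennreal ((1 - t) powr (1 - p) * I + t powr (1 - p) * ((1 / real K) powr p * (real K * (err_const * A powr (- p / 2) + 1))))"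
    using I(2) err_const_pos by (simp add: ennreal_mult ennreal_plus)
  also have "\<dots> \<le> ennreal (I + \<epsilon>)" by (rule ennreal_leI) (rule tKA)
  also have "\<dots> = Lp_on p UNIV F + ennreal \<epsilon>" using I \<epsilon> by (simp add: ennreal_plus)
  finally show ?thesis
    using KT pos close cover unfolding F_def by (intro exI[of _ "K * T"] exI[of _ y'] exI[of _ \<delta>']) auto
qed

end

subsection \<open>The limit\<close>

lemma hausdorff_measure_eq_0I:
  fixes S :: "'a::euclidean_space set"
  assumes s: "0 < s"
    and cover: "\<And>\<epsilon>. 0 < \<epsilon> \<Longrightarrow> \<exists>Q. finite Q \<and> S \<subseteq> (\<Union>q\<in>Q. cball (fst q) (snd q)) \<and>
      (\<forall>q\<in>Q. 0 \<le> snd q \<and> snd q \<le> \<epsilon>) \<and> (\<Sum>q\<in>Q. snd q powr s) \<le> \<epsilon>"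
  shows "hausdorff_measure s S = 0"
proof -
  have "hausdorff_content s \<delta> S \<le> ennreal e" if "0 < \<delta>" "0 < e" for \<delta> e
  proof -
    \<comment> \<open>Diameters are twice the radii: this explains \<open>\<delta> / 2\<close>, and
      the factor \<open>2 powr s\<close> in the sum.\<close>
    define \<epsilon> where "\<epsilon> = min (\<delta> / 2) (e / 2 powr s)"
    have "\<epsilon> > 0" using that by (simp add: \<epsilon>_def)
    from cover[OF this] obtain Q where Q: "finite Q" "S \<subseteq> (\<Union>q\<in>Q. cball (fst q) (snd q))"
      "\<And>q. q \<in> Q \<Longrightarrow> 0 \<le> snd q" "\<And>q. q \<in> Q \<Longrightarrow> snd q \<le> \<epsilon>" "(\<Sum>q\<in>Q. snd q powr s) \<le> \<epsilon>" by auto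
    obtain h where h: "bij_betw h {..<card Q} Q"
      using ex_bij_betw_nat_finite[OF Q(1)] by (auto simp: atLeast0LessThan)
    define U where "U k = (if k < card Q then cball (fst (h k)) (snd (h k)) else {})" for k
    have hQ: "h k \<in> Q" if "k < card Q" for k using h that by (auto simp: bij_betw_def)
    have "S \<subseteq> (\<Union>k. U k)"
    proof
      fix x assume "x \<in> S"
      then obtain q where q: "q \<in> Q" "x \<in> cball (fst q) (snd q)" using Q(2) by auto
      then obtain k where "k < card Q" "q = h k" using h by (auto simp: bij_betw_def)
      then show "x \<in> (\<Union>k. U k)" using q by (intro UN_I[of k]) (auto simp: U_def)
    qed
    moreover have "bounded (U k) \<and> diameter (U k) \<le> \<delta>" for k
      using hQ[of k] Q(3,4)[of "h k"] that(1) by (auto simp: U_def diameter_cball \<epsilon>_def)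
    ultimately have "U \<in> countable_covers \<delta> S" by (simp add: countable_covers_def)
    then have "hausdorff_content s \<delta> S \<le> (\<Sum>k. diam_powr s (U k))"
      unfolding hausdorff_content_def by (rule INF_lower)
    also have "\<dots> = (\<Sum>k<card Q. diam_powr s (U k))"
      by (rule suminf_finite) (auto simp: U_def diam_powr_def)
    also have "\<dots> = (\<Sum>k<card Q. ennreal ((2 * snd (h k)) powr s))"
      using s hQ Q(3) by (intro sum.cong) (auto simp: U_def diam_powr_def diameter_cball not_less)
    also have "\<dots> = (\<Sum>q\<in>Q. ennreal ((2 * snd q) powr s))"
      by (rule sum.reindex_bij_betw[OF h])
    also have "\<dots> = ennreal (\<Sum>q\<in>Q. (2 * snd q) powr s)" by (rule sum_ennreal) simp
    also have "(\<Sum>q\<in>Q. (2 * snd q) powr s) = 2 powr s * (\<Sum>q\<in>Q. snd q powr s)"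
      unfolding sum_distrib_left using Q(3) by (intro sum.cong) (auto simp: powr_mult)
    also have "\<dots> \<le> 2 powr s * \<epsilon>" using Q(5) by (intro mult_left_mono) auto
    also have "\<dots> \<le> 2 powr s * (e / 2 powr s)" by (intro mult_left_mono) (auto simp: \<epsilon>_def)
    also have "\<dots> = e" by simp
    finally show ?thesis by (simp add: ennreal_leI)
  qed
  then have "hausdorff_content s \<delta> S = 0" if "0 < \<delta>" for \<delta>
    using that ennreal_le_epsilon[of 0 "hausdorff_content s \<delta> S"] by simp
  then show ?thesis unfolding hausdorff_measure_def by (simp add: SUP_constant)
qed

section \<open>The unit interval as parameter space for chains of nested cells\<close>

definition unit_measure :: "real measure" where
  "unit_measure = restrict_space lborel {0..<1}"

lemma space_unit_measure: "space unit_measure = {0..<1}"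
  by (simp add: unit_measure_def space_restrict_space)

lemma prob_space_unit_measure: "prob_space unit_measure"
  by standard (simp add: space_unit_measure, simp add: unit_measure_def emeasure_restrict_space)

lemma measurable_unit_measure [measurable (raw)]: "f \<in> borel_measurable borel \<Longrightarrow> f \<in> borel_measurable unit_measure"
  unfolding unit_measure_def by (rule measurable_restrict_space1) simp

text \<open>Cuts the unit interval into \<open>m\<close> equal half-open pieces, one per cell of a
  state, so that Lebesgue measure gives all cells the same weight.\<close>

definition slot :: "nat \<Rightarrow> real \<Rightarrow> nat" where "slot m t = nat \<lfloor>real m * t\<rfloor>"

lemma slot_less:
  assumes "0 < m" "t \<in> {0..<1}"
  shows "slot m t < m"
proof -
  have "real m * t < real m" using assms by simp
  then have "\<lfloor>real m * t\<rfloor> < int m" by (simp add: floor_less_iff)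
  then show ?thesis using assms(1) by (simp add: slot_def)
qed

text \<open>Makes the cells containing a fixed \<open>t\<close> a chain: the index at the finer
  level has the coarser index as its parent.\<close>

lemma slot_mult_div:
  assumes "0 < L" "t \<in> {0..<1}"
  shows "slot (m * L) t div L = slot m t"
proof -
  have "\<lfloor>real m * t\<rfloor> = \<lfloor>(real (m * L) * t) / real_of_int (int L)\<rfloor>"
    using assms by simp
  also have "\<dots> = \<lfloor>real (m * L) * t\<rfloor> div int L" by (rule floor_divide_real_eq_div) simp
  finally show ?thesis using assms by (simp add: slot_def nat_div_distrib')
qed

lemma slot_eq_iff:
  assumes "0 < m" "t \<in> {0..<1}"
  shows "slot m t = i \<longleftrightarrow> t \<in> {real i / real m..<(real i + 1) / real m}"
proof -
  have "slot m t = i \<longleftrightarrow> \<lfloor>real m * t\<rfloor> = int i"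
    using assms by (auto simp: slot_def)
  also have "\<dots> \<longleftrightarrow> t \<in> {real i / real m..<(real i + 1) / real m}"
    using assms(1) by (auto simp: floor_eq_iff field_simps)
  finally show ?thesis .
qed

lemma measurable_slot [measurable]: "slot m \<in> measurable borel (count_space UNIV)"
  unfolding slot_def[abs_def] by measurable

lemma integral_slot:
  fixes g :: "nat \<Rightarrow> complex"
  assumes m: "0 < m"
  shows "(\<integral>t. g (slot m t) \<partial>unit_measure) = (\<Sum>i<m. g i) / of_nat m"
proof -
  define J where "J i = {real i / real m..<(real i + 1) / real m}" for i
  have J: "J i \<subseteq> {0..<1}" if "i < m" for i
  proof -
    have "real i + 1 \<le> real m" using that by linarith
    then show ?thesis using m by (auto simp: J_def field_simps intro: order_trans less_le_trans)
  qed
  have [measurable]: "J i \<in> sets borel" for i by (simp add: J_def)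
  have em: "emeasure lborel (J i) = ennreal (1 / real m)" for i
    unfolding J_def using m by (subst emeasure_lborel_Ico) (auto simp: divide_simps)
  have "(\<integral>t. g (slot m t) \<partial>unit_measure) = (\<integral>t. indicator {0..<1} t *\<^sub>R g (slot m t) \<partial>lborel)"
    unfolding unit_measure_def by (rule integral_restrict_space) simp
  also have "\<dots> = (\<integral>t. (\<Sum>i<m. indicator (J i) t *\<^sub>R g i) \<partial>lborel)"
  proof (rule Bochner_Integration.integral_cong[OF refl])
    fix t :: real
    show "indicator {0..<1} t *\<^sub>R g (slot m t) = (\<Sum>i<m. indicator (J i) t *\<^sub>R g i)"
    proof (cases "t \<in> {0..<1}")
      case True
      have "(\<Sum>i<m. indicator (J i) t *\<^sub>R g i) = (\<Sum>i<m. if i = slot m t then g i else 0)"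
        unfolding indicator_def J_def slot_eq_iff[OF m True, symmetric] by (intro sum.cong) auto
      then show ?thesis using True slot_less[OF m True] by simp
    next
      case False
      then have "t \<notin> J i" if "i < m" for i using J[OF that] by blast
      then show ?thesis using False by simp
    qed
  qed
  also have "\<dots> = (\<Sum>i<m. (\<integral>t. indicator (J i) t *\<^sub>R g i \<partial>lborel))"
    by (rule Bochner_Integration.integral_sum)
      (auto simp: em intro!: integrable_scaleR_left integrable_real_indicator)
  also have "\<dots> = (\<Sum>i<m. g i / of_nat m)"
  proof (intro sum.cong refl)
    fix i
    have "measure lborel (J i) = 1 / real m"
      by (simp add: measure_def em)
    then show "(\<integral>t. indicator (J i) t *\<^sub>R g i \<partial>lborel) = g i / of_nat m"
      by (simp add: em scaleR_conv_of_real)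
  qed
  finally show ?thesis by (simp add: sum_divide_distrib)
qed

section \<open>The limit measure and its compact carrier\<close>

text \<open>The outcome of iterating the refinement: \<open>j div L n\<close> is the parent of cell
  \<open>j\<close>, radii at least halve, and the covering sums tend to 0 while the integrals stay
  bounded.\<close>

locale refining_states = bump +
  fixes M L :: "nat \<Rightarrow> nat" and y :: "nat \<Rightarrow> nat \<Rightarrow> 'a" and \<delta> :: "nat \<Rightarrow> nat \<Rightarrow> real" and C :: real
  assumes M_pos: "0 < M n" and L_pos: "0 < L n" and \<delta>_pos: "0 < \<delta> n i"
    and M_Suc: "M (Suc n) = M n * L n"
    and y_Suc: "j < M (Suc n) \<Longrightarrow> norm (y (Suc n) j - y n (j div L n)) \<le> \<delta> n (j div L n)"
    and \<delta>_Suc: "j < M (Suc n) \<Longrightarrow> \<delta> (Suc n) j \<le> \<delta> n (j div L n) / 2"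
    and \<delta>_Suc_le: "j < M (Suc n) \<Longrightarrow> \<delta> (Suc n) j \<le> (1 / 2) ^ n"
    and cover_Suc: "(\<Sum>q\<in>(\<lambda>j. (y (Suc n) j, \<delta> (Suc n) j)) ` {..<M (Suc n)}. snd q powr \<alpha>) \<le> (1 / 2) ^ n"
    and Lp_le: "Lp_on p UNIV (state_ft (M n) (y n) (\<delta> n)) \<le> ennreal C"
begin

definition X :: "nat \<Rightarrow> real \<Rightarrow> 'a" where "X n t = y n (slot (M n) t)"
definition D :: "nat \<Rightarrow> real \<Rightarrow> real" where "D n t = \<delta> n (slot (M n) t)"
definition limX :: "real \<Rightarrow> 'a" where "limX t = lim (\<lambda>n. X n t)"

lemma D_pos: "0 < D n t" by (simp add: D_def \<delta>_pos)

lemma step: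
  assumes "t \<in> {0..<1}"
  shows "norm (X (Suc n) t - X n t) \<le> D n t" "D (Suc n) t \<le> D n t / 2" "D (Suc n) t \<le> (1 / 2) ^ n"
proof -
  have "slot (M (Suc n)) t < M (Suc n)" using assms M_pos by (intro slot_less)
  moreover have "slot (M (Suc n)) t div L n = slot (M n) t"
    unfolding M_Suc using L_pos assms by (rule slot_mult_div)
  ultimately show "norm (X (Suc n) t - X n t) \<le> D n t" "D (Suc n) t \<le> D n t / 2" "D (Suc n) t \<le> (1 / 2) ^ n"
    using y_Suc \<delta>_Suc \<delta>_Suc_le by (fastforce simp: X_def D_def)+
qed

lemma D_tendsto_0:
  assumes "t \<in> {0..<1}"
  shows "(\<lambda>n. D n t) \<longlonglongrightarrow> 0"
\<comment> \<open>The geometric bound on the radii starts at level \<open>Suc n\<close>; the initial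
  radii are not covered by it.\<close>
proof (rule LIMSEQ_imp_Suc, rule tendsto_sandwich[where f = "\<lambda>_. 0" and h = "\<lambda>n. (1 / 2) ^ n"])
  show "(\<lambda>n. (1 / 2 :: real) ^ n) \<longlonglongrightarrow> 0" by (rule LIMSEQ_power_zero) simp
qed (use step(3)[OF assms] D_pos in \<open>auto simp: less_imp_le\<close>)

text \<open>A telescoping form: halving gives \<open>D n t \<le> 2 * (D n t - D (Suc n) t)\<close>,
  so each step is paid for by the decrease of the radius. It yields both the Cauchy property and the
  distance \<open>2 * D n t\<close> to the limit.\<close>

lemma norm_X_diff_le:
  assumes "t \<in> {0..<1}"
  shows "norm (X (n + k) t - X n t) \<le> 2 * (D n t - D (n + k) t)"
proof (induction k)
  case (Suc k)
  have "norm (X (n + Suc k) t - X n t) \<le> norm (X (Suc (n + k)) t - X (n + k) t) + norm (X (n + k) t - X n t)"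
    using norm_triangle_ineq[of "X (Suc (n + k)) t - X (n + k) t" "X (n + k) t - X n t"] by simp
  also have "\<dots> \<le> D (n + k) t + 2 * (D n t - D (n + k) t)"
    using step(1)[OF assms] Suc by (rule add_mono)
  also have "\<dots> \<le> 2 * (D n t - D (n + Suc k) t)"
    using step(2)[OF assms, of "n + k"] by simp
  finally show ?case .
qed simp

lemma X_tendsto:
  assumes t: "t \<in> {0..<1}"
  shows "(\<lambda>n. X n t) \<longlonglongrightarrow> limX t"
proof -
  have "Cauchy (\<lambda>n. X n t)"
  proof (rule CauchyI')
    fix e :: real assume "0 < e"
    then have "\<forall>\<^sub>F n in sequentially. D n t < e / 2"
      by (intro order_tendstoD(2)[OF D_tendsto_0[OF t]]) simp
    then obtain N where N: "\<And>n. n \<ge> N \<Longrightarrow> D n t < e / 2" by (auto simp: eventually_sequentially)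
    have "dist (X m t) (X n t) < e" if "m \<ge> N" "n > m" for m n
    proof -
      have "norm (X n t - X m t) \<le> 2 * (D m t - D n t)"
        using norm_X_diff_le[OF t, of m "n - m"] that by simp
      then show ?thesis using N[OF that(1)] D_pos[of n t] by (simp add: dist_norm norm_minus_commute)
    qed
    then show "\<exists>N. \<forall>m\<ge>N. \<forall>n>m. dist (X m t) (X n t) < e" by blast
  qed
  then show ?thesis unfolding limX_def by (metis Cauchy_convergent convergent_LIMSEQ_iff)
qed

lemma norm_limX_le:
  assumes t: "t \<in> {0..<1}"
  shows "norm (limX t - X n t) \<le> 2 * D n t"
proof (rule tendsto_upperbound)
  show "(\<lambda>k. norm (X (k + n) t - X n t)) \<longlonglongrightarrow> norm (limX t - X n t)"
    by (intro tendsto_intros LIMSEQ_ignore_initial_segment X_tendsto t)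
  show "\<forall>\<^sub>F k in sequentially. norm (X (k + n) t - X n t) \<le> 2 * D n t"
  proof (intro always_eventually allI)
    fix k
    show "norm (X (k + n) t - X n t) \<le> 2 * D n t"
      using norm_X_diff_le[OF t, of n k] D_pos[of "n + k" t] by (simp add: add.commute)
  qed
qed simp

lemma measurable_X [measurable]: "X n \<in> borel_measurable borel" and measurable_D [measurable]: "D n \<in> borel_measurable borel"
  unfolding X_def[abs_def] D_def[abs_def] by measurable

lemma measurable_limX [measurable]: "limX \<in> borel_measurable borel"
  unfolding limX_def[abs_def] by measurable

definition limit_measure :: "'a measure" where "limit_measure = distr unit_measure borel limX"

lemma sets_limit_measure [simp, measurable_cong]: "sets limit_measure = sets borel"
  by (simp add: limit_measure_def)

lemma prob_space_limit_measure: "prob_space limit_measure"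
  unfolding limit_measure_def by (rule prob_space.prob_space_distr[OF prob_space_unit_measure]) measurable

text \<open>Balls of doubled radius, because a limit point may lie up to twice the radius away from
  the centre of its cell.\<close>

definition limit_set :: "'a set" where
  "limit_set = (\<Inter>n. \<Union>i<M n. cball (y n i) (2 * \<delta> n i))"

lemma limX_in_limit_set:
  assumes "t \<in> {0..<1}"
  shows "limX t \<in> limit_set"
  unfolding limit_set_def
proof (intro INT_I UN_I)
  fix n
  show "slot (M n) t \<in> {..<M n}" using slot_less[OF M_pos assms] by simp
  show "limX t \<in> cball (y n (slot (M n) t)) (2 * \<delta> n (slot (M n) t))"
    using norm_limX_le[OF assms, of n] by (simp add: X_def D_def dist_norm norm_minus_commute)
qed

lemma compact_limit_set: "compact limit_set"
proof -
  have cl: "closed limit_set" unfolding limit_set_def by (intro closed_INT ballI closed_UN) auto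
  have "compact (\<Union>i<M 0. cball (y 0 i) (2 * \<delta> 0 i))" by (intro compact_UN) auto
  from compact_Int_closed[OF this cl] show ?thesis
    by (rule arg_cong[where f = compact, THEN iffD1, rotated]) (auto simp: limit_set_def)
qed

lemma support_limit_measure: "measure_support limit_measure \<subseteq> limit_set"
proof
  fix x assume x: "x \<in> measure_support limit_measure"
  show "x \<in> limit_set"
  proof (rule ccontr)
    assume "x \<notin> limit_set"
    moreover have "open (- limit_set)" using compact_limit_set by (simp add: compact_imp_closed open_Compl)
    ultimately have "emeasure limit_measure (- limit_set) > 0"
      using x by (auto simp: measure_support_def)
    moreover have "limX -` (- limit_set) \<inter> space unit_measure = {}"
      using limX_in_limit_set by (auto simp: space_unit_measure)
    then have "emeasure limit_measure (- limit_set) = 0"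
      using \<open>open (- limit_set)\<close> unfolding limit_measure_def by (subst emeasure_distr) auto
    ultimately show False by simp
  qed
qed

lemma hausdorff_limit_set: "hausdorff_measure \<alpha> limit_set = 0"
proof (rule hausdorff_measure_eq_0I[OF \<alpha>_pos])
  fix \<epsilon> :: real assume \<epsilon>: "0 < \<epsilon>"
  \<comment> \<open>Doubling the radii costs 2 in the mesh and \<open>2 powr \<alpha>\<close> in the
    covering sum; one \<open>n\<close> must handle both.\<close>
  have "(\<lambda>n. max 2 (2 powr \<alpha>) * (1 / 2) ^ n) \<longlonglongrightarrow> max 2 (2 powr \<alpha>) * 0"
    by (intro tendsto_intros LIMSEQ_power_zero) simp
  then have "\<forall>\<^sub>F n in sequentially. max 2 (2 powr \<alpha>) * (1 / 2) ^ n < \<epsilon>"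
    using \<epsilon> by (intro order_tendstoD) auto
  then obtain n where n: "max 2 (2 powr \<alpha>) * (1 / 2) ^ n < \<epsilon>" by (auto simp: eventually_sequentially)
  have "2 * (1 / 2) ^ n \<le> max 2 (2 powr \<alpha>) * (1 / 2) ^ n" "2 powr \<alpha> * (1 / 2) ^ n \<le> max 2 (2 powr \<alpha>) * (1 / 2) ^ n"
    by (intro mult_right_mono; simp)+
  with n have n1: "2 * (1 / 2) ^ n \<le> \<epsilon>" and n2: "2 powr \<alpha> * (1 / 2) ^ n \<le> \<epsilon>" by linarith+
  define Q where "Q = (\<lambda>j. (y (Suc n) j, \<delta> (Suc n) j)) ` {..<M (Suc n)}"
  define Q' where "Q' = (\<lambda>q. (fst q, 2 * snd q)) ` Q"
  have fin: "finite Q" by (simp add: Q_def)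
  have Q: "0 < snd q \<and> snd q \<le> (1 / 2) ^ n" if "q \<in> Q" for q
    using that \<delta>_pos \<delta>_Suc_le by (auto simp: Q_def)
  have "limit_set \<subseteq> (\<Union>q\<in>Q'. cball (fst q) (snd q))"
  proof
    fix x assume "x \<in> limit_set"
    then obtain j where "j < M (Suc n)" "x \<in> cball (y (Suc n) j) (2 * \<delta> (Suc n) j)"
      unfolding limit_set_def by blast
    then show "x \<in> (\<Union>q\<in>Q'. cball (fst q) (snd q))" by (auto simp: Q'_def Q_def)
  qed
  moreover have "0 \<le> snd q \<and> snd q \<le> \<epsilon>" if "q \<in> Q'" for q
    using that n1 Q by (fastforce simp: Q'_def)
  moreover have "(\<Sum>q\<in>Q'. snd q powr \<alpha>) \<le> \<epsilon>"
  proof -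
    have "(\<Sum>q\<in>Q'. snd q powr \<alpha>) \<le> sum ((\<lambda>q. snd q powr \<alpha>) \<circ> (\<lambda>q. (fst q, 2 * snd q))) Q"
      unfolding Q'_def using fin by (intro sum_image_le) auto
    also have "\<dots> = 2 powr \<alpha> * (\<Sum>q\<in>Q. snd q powr \<alpha>)"
      unfolding sum_distrib_left using Q by (intro sum.cong) (auto simp: powr_mult less_imp_le)
    also have "\<dots> \<le> 2 powr \<alpha> * (1 / 2) ^ n"
      using cover_Suc[of n] unfolding Q_def by (intro mult_left_mono) auto
    finally show ?thesis using n2 by linarith
  qed
  ultimately show "\<exists>Q. finite Q \<and> limit_set \<subseteq> (\<Union>q\<in>Q. cball (fst q) (snd q)) \<and>
      (\<forall>q\<in>Q. 0 \<le> snd q \<and> snd q \<le> \<epsilon>) \<and> (\<Sum>q\<in>Q. snd q powr \<alpha>) \<le> \<epsilon>"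
    using fin by (intro exI[of _ Q']) (auto simp: Q'_def)
qed

text \<open>Over the unit interval the state becomes an integral of cell transforms bounded by 1.
  For each \<open>t\<close> the centre converges and the radius tends to 0, so the bump factor tends
  to 1.\<close>

lemma state_ft_tendsto: "(\<lambda>n. state_ft (M n) (y n) (\<delta> n) \<xi>) \<longlonglongrightarrow> fourier_transform limit_measure \<xi>"
proof -
  interpret U: prob_space unit_measure by (rule prob_space_unit_measure)
  have eq: "state_ft (M n) (y n) (\<delta> n) \<xi> = (\<integral>t. cell_ft (X n t) (D n t) \<xi> \<partial>unit_measure)" for n
    unfolding X_def D_def state_ft_def by (rule integral_slot[symmetric]) (rule M_pos)
  have "fourier_transform limit_measure \<xi> = (\<integral>t. fchar (limX t) \<xi> \<partial>unit_measure)"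
    unfolding fourier_transform_fchar limit_measure_def by (rule integral_distr) measurable
  moreover have "(\<lambda>n. (\<integral>t. cell_ft (X n t) (D n t) \<xi> \<partial>unit_measure)) \<longlonglongrightarrow> (\<integral>t. fchar (limX t) \<xi> \<partial>unit_measure)"
  proof (rule integral_dominated_convergence[where w = "\<lambda>_. 1"])
    show "AE t in unit_measure. (\<lambda>n. cell_ft (X n t) (D n t) \<xi>) \<longlonglongrightarrow> fchar (limX t) \<xi>"
    proof (rule AE_I2)
      fix t assume "t \<in> space unit_measure"
      then have t: "t \<in> {0..<1}" by (simp add: space_unit_measure)
      have "(\<lambda>n. fchar (X n t) \<xi>) \<longlonglongrightarrow> fchar (limX t) \<xi>"
        unfolding fchar_def cis_conv_exp by (intro tendsto_intros X_tendsto t)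
      from tendsto_mult[OF this tendsto_\<psi>[OF D_tendsto_0[OF t], of \<xi>]]
      show "(\<lambda>n. cell_ft (X n t) (D n t) \<xi>) \<longlonglongrightarrow> fchar (limX t) \<xi>"
        by (simp add: cell_ft_def)
    qed
    show "(\<lambda>t. cell_ft (X n t) (D n t) \<xi>) \<in> borel_measurable unit_measure" for n
      unfolding cell_ft_def by measurable
  qed (auto simp: norm_cell_ft_le)
  ultimately show ?thesis by (simp add: eq)
qed

lemma in_Lp_limit_measure: "in_Lp p (fourier_transform limit_measure)"
proof -
  let ?f = "fourier_transform limit_measure"
  have m [measurable]: "?f \<in> borel_measurable borel"
    by (intro borel_measurable_continuous_onI continuous_on_fourier_transform prob_space_limit_measure sets_limit_measure)
  have lim: "liminf (\<lambda>n. ennreal (norm (state_ft (M n) (y n) (\<delta> n) \<xi>) powr p)) = ennreal (norm (?f \<xi>) powr p)" for \<xi>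
    by (intro lim_imp_Liminf tendsto_ennrealI tendsto_powr2 tendsto_norm state_ft_tendsto)
      (use p_gt_2 in auto)
  have "(\<integral>\<^sup>+\<xi>. ennreal (norm (?f \<xi>) powr p) \<partial>lborel) \<le>
      liminf (\<lambda>n. \<integral>\<^sup>+\<xi>. ennreal (norm (state_ft (M n) (y n) (\<delta> n) \<xi>) powr p) \<partial>lborel)"
    unfolding lim[symmetric] by (rule nn_integral_liminf) measurable
  also have "\<dots> \<le> limsup (\<lambda>n. \<integral>\<^sup>+\<xi>. ennreal (norm (state_ft (M n) (y n) (\<delta> n) \<xi>) powr p) \<partial>lborel)"
    by (rule Liminf_le_Limsup) simp
  also have "\<dots> \<le> ennreal C"
    using Lp_le by (intro Limsup_bounded always_eventually allI) (simp add: Lp_on_def)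
  also have "\<dots> < \<infinity>" by simp
  finally have "integrable lborel (\<lambda>\<xi>. norm (?f \<xi>) powr p)"
    by (intro integrableI_bounded) auto
  then show ?thesis
    unfolding in_Lp_def by (auto simp: integrable_completion intro: measurable_completion)
qed

end

section \<open>Iterating the refinement\<close>

context bump
begin

lemma exists_measure:
  "\<exists>(S :: 'a set) \<mu>. compact S \<and> sets \<mu> = sets borel \<and> prob_space \<mu> \<and> measure_support \<mu> \<subseteq> S \<and>
     in_Lp p (fourier_transform \<mu>) \<and> hausdorff_measure \<alpha> S = 0"
proof -
  define Lpn where "Lpn s = Lp_on p UNIV (state_ft (fst s) (fst (snd s)) (snd (snd s)))" for s
  define ok where "ok s \<longleftrightarrow> 0 < fst s \<and> (\<forall>i. 0 < snd (snd s) i) \<and> Lpn s < \<infinity>" for s :: "nat \<times> (nat \<Rightarrow> 'a) \<times> (nat \<Rightarrow> real)"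
  define R where "R n s s' \<longleftrightarrow> (\<exists>L>0. fst s' = fst s * L \<and>
    (\<forall>j<fst s'. norm (fst (snd s') j - fst (snd s) (j div L)) \<le> snd (snd s) (j div L) \<and>
       snd (snd s') j \<le> (1 / 2) ^ n \<and> snd (snd s') j \<le> snd (snd s) (j div L) / 2)) \<and>
    (\<Sum>q\<in>(\<lambda>j. (fst (snd s') j, snd (snd s') j)) ` {..<fst s'}. snd q powr \<alpha>) \<le> (1 / 2) ^ n \<and>
    Lpn s' \<le> Lpn s + ennreal ((1 / 2) ^ n)" for n s s'
  \<comment> \<open>A single unit bump at the origin, whose transform is \<open>\<psi>\<close>
    itself; the radius is set to 1 at every index since \<open>ok\<close> asks for positivity
    everywhere.\<close>
  define s0 where "s0 = (1 :: nat, \<lambda>_::nat. 0 :: 'a, \<lambda>_::nat. 1 :: real)"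
  have "Lpn s0 < \<infinity>"
    using Lp_bump by (simp add: s0_def Lpn_def Lp_on_def state_ft_def cell_ft_def)
  then have ok0: "ok s0" by (simp add: ok_def s0_def)
  have step: "\<exists>s'. ok s' \<and> R n s s'" if "ok s" for n s
  proof -
    have "0 < fst s" "\<And>i. 0 < snd (snd s) i" "Lp_on p UNIV (state_ft (fst s) (fst (snd s)) (snd (snd s))) < \<infinity>"
      using that by (auto simp: ok_def Lpn_def)
    from refine[OF this, of "(1 / 2) ^ n"] obtain L y' \<delta>' where *: "0 < L" "\<forall>j. 0 < \<delta>' j"
      "\<forall>j<fst s * L. norm (y' j - fst (snd s) (j div L)) \<le> snd (snd s) (j div L) \<and> \<delta>' j \<le> (1 / 2) ^ n \<and> \<delta>' j \<le> snd (snd s) (j div L) / 2"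
      "(\<Sum>q\<in>(\<lambda>j. (y' j, \<delta>' j)) ` {..<fst s * L}. snd q powr \<alpha>) \<le> (1 / 2) ^ n"
      "Lp_on p UNIV (state_ft (fst s * L) y' \<delta>') \<le> Lpn s + ennreal ((1 / 2) ^ n)"
      unfolding Lpn_def by auto
    have "Lp_on p UNIV (state_ft (fst s * L) y' \<delta>') < \<infinity>"
      using *(5) that by (auto simp: ok_def intro: order.strict_trans1)
    then show ?thesis
      using * that by (intro exI[of _ "(fst s * L, y', \<delta>')"]) (auto simp: ok_def R_def Lpn_def)
  qed
  obtain s where s: "s 0 = s0" "\<And>n. ok (s n)" "\<And>n. R n (s n) (s (Suc n))"
  proof -
    \<comment> \<open>The starting state is pinned down by building it into the invariant at index
      0.\<close>
    have "\<exists>f. \<forall>n. (ok (f n) \<and> (n = 0 \<longrightarrow> f n = s0)) \<and> R n (f n) (f (Suc n))"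
    proof (rule dependent_nat_choice)
      show "\<exists>x. ok x \<and> (0 = (0::nat) \<longrightarrow> x = s0)" using ok0 by blast
    next
      fix x and n :: nat assume "ok x \<and> (n = 0 \<longrightarrow> x = s0)"
      then show "\<exists>x'. (ok x' \<and> (Suc n = 0 \<longrightarrow> x' = s0)) \<and> R n x x'" using step by blast
    qed
    then show ?thesis using that by blast
  qed
  define Q where "Q n L \<longleftrightarrow> 0 < L \<and> fst (s (Suc n)) = fst (s n) * L \<and>
    (\<forall>j<fst (s (Suc n)). norm (fst (snd (s (Suc n))) j - fst (snd (s n)) (j div L)) \<le> snd (snd (s n)) (j div L) \<and>
       snd (snd (s (Suc n))) j \<le> (1 / 2) ^ n \<and> snd (snd (s (Suc n))) j \<le> snd (snd (s n)) (j div L) / 2)" for n L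
  have "\<forall>n. \<exists>L. Q n L" using s(3) by (auto simp: R_def Q_def)
  then obtain L where L: "\<And>n. Q n (L n)" by metis
  \<comment> \<open>The increments \<open>(1 / 2) ^ n\<close> add up to at most 2; the next claim
    keeps the exact partial sum so that the induction closes.\<close>
  define C where "C = enn2real (Lpn s0) + 2"
  have Lp: "Lpn (s n) \<le> ennreal (enn2real (Lpn s0) + (2 - 2 * (1 / 2) ^ n))" for n
  proof (induction n)
    case 0
    show ?case using ok0 by (simp add: s(1) ok_def)
  next
    case (Suc n)
    have le: "2 * (1 / 2 :: real) ^ n \<le> 2" by (simp add: power_le_one)
    have "Lpn (s (Suc n)) \<le> Lpn (s n) + ennreal ((1 / 2) ^ n)" using s(3) by (auto simp: R_def)
    also have "\<dots> \<le> ennreal (enn2real (Lpn s0) + (2 - 2 * (1 / 2) ^ n)) + ennreal ((1 / 2) ^ n)"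
      using Suc by (rule add_right_mono)
    also have "\<dots> = ennreal ((enn2real (Lpn s0) + (2 - 2 * (1 / 2) ^ n)) + (1 / 2) ^ n)"
      using le by (intro ennreal_plus[symmetric] add_nonneg_nonneg) auto
    also have "(enn2real (Lpn s0) + (2 - 2 * (1 / 2) ^ n)) + (1 / 2) ^ n = enn2real (Lpn s0) + (2 - 2 * (1 / 2) ^ Suc n)"
      by simp
    finally show ?case .
  qed
  interpret refining_states \<phi> p \<alpha> "\<lambda>n. fst (s n)" L "\<lambda>n. fst (snd (s n))" "\<lambda>n. snd (snd (s n))" C
  proof
    fix n
    show "Lp_on p UNIV (state_ft (fst (s n)) (fst (snd (s n))) (snd (snd (s n)))) \<le> ennreal C"
      unfolding Lpn_def[symmetric] by (rule order_trans[OF Lp ennreal_leI]) (simp add: C_def)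
  qed (use s L in \<open>auto simp: ok_def Q_def R_def\<close>)
  show ?thesis
    using compact_limit_set prob_space_limit_measure support_limit_measure in_Lp_limit_measure hausdorff_limit_set
    by (intro exI[of _ limit_set] exI[of _ limit_measure]) simp
qed

end

theorem theorem1p6:
  fixes p :: real
  assumes "2 < p"
  shows "\<exists>(S :: (real ^ 'n::finite) set) (\<mu> :: (real ^ 'n) measure).
           compact S \<and>
           sets \<mu> = sets borel \<and> prob_space \<mu> \<and>
           measure_support \<mu> \<subseteq> S \<and>
           in_Lp p (fourier_transform \<mu>) \<and>
           hausdorff_measure (2 * real CARD('n) / p) S = 0"
proof -
  obtain \<phi> :: "(real ^ 'n) measure" where \<phi>: "prob_space \<phi>" "sets \<phi> = sets borel" "AE x in \<phi>. norm x \<le> 1"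
     "(\<integral>\<^sup>+\<xi>. ennreal (norm (fourier_transform \<phi> \<xi>) powr p) \<partial>lborel) < \<infinity>"
    using exists_bump[OF less_imp_le[OF assms]] by (elim exE conjE) (rule that)
  interpret bump \<phi> p "2 * real CARD('n) / p"
    using assms \<phi> by (intro bump.intro) simp_all
  show ?thesis by (rule exists_measure)
qed

end
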